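(* Consider either a sequence of weighted branching processes (Case 1) or a sequence of weighted branching trees (Case 2), with associated measures $\mu_n,\mu$ (and $\nu_n^*,\nu^*$ in Case 2), processes $\{R^{(n,k)}:k\ge0\}$, $n\ge1$, limiting process $\{R^{(k)}:k\ge0\}$ and constant $\rho$, all as defined in the context. Suppose that as $n\to\infty$, $$d_1(\mu_n,\mu)\to0\ \ (\text{Case 1})\qquad\text{or}\qquad d_1(\nu_n^*,\nu^* )+d_1(\mu_n,\mu)\to0\ \ (\text{Case 2}).$$ Then for any fixed $k\in\mathbb N$, the law of $R^{(n,k)}$ converges in $d_1$ to the law of $R^{(k)}$ as $n\to\infty$. Moreover, if $\rho<1$, then for any sequence $k_n\in\mathbb N$ with $k_n\to\infty$ as $n\to\infty$, the law of $R^{(n,k_n)}$ converges in $d_1$ to the law of $R$ as $n\to\infty$, where $R=\sum_{k=0}^\infty\sum_{\mathbf i\in A_k}\Pi_{\mathbf i}Q_{\mathbf i}$ is the a.s. limit of $R^{(k)}$ as $k\to\infty$.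
   Context: Kantorovich-Rubinstein distance: for probability measures $\mu,\nu$ on $\mathcal S=\mathbb R^d$ or $\mathcal S$ = the space of real sequences with finite $\ell_1$ norm, $d_1(\mu,\nu)=\inf E[\|\mathbf X-\mathbf Y\|_1]$ over all couplings $(\mathbf X,\mathbf Y)$ with $\mathbf X\sim\mu$, $\mathbf Y\sim\nu$; $\|\cdot\|_1$ is the $\ell_1$ norm. All measures to which $d_1$ is applied are assumed to have finite first moment $\int\|\mathbf x\|_1\,d\mu<\infty$. Trees: $\mathbb N=\{0,1,2,\dots\}$, $\mathbb N_+=\{1,2,\dots\}$, $U=\bigcup_{k\ge0}\mathbb N_+^k$, $\mathbb N_+^0=\{\emptyset\}$; $(\mathbf i,r)$ is concatenation. Given offspring numbers $N_{\mathbf i}$ and weights, $A_0=\{\emptyset\}$, $A_n=\{(\mathbf i,r):\mathbf i\in A_{n-1},1\le r\le N_{\mathbf i}\}$, $\Pi_\emptyset=1$, $\Pi_{(\mathbf i,r)}=C_{(\mathbf i,r)}\Pi_{\mathbf i}$, and $$R^{(k)}=\sum_{j=0}^k\sum_{\mathbf i\in A_j}Q_{\mathbf i}\Pi_{\mathbf i}\quad(k\ge0).$$ - Weighted branching process with generic branching vector $(Q,N,C_1,C_2,\dots)$, $N\in\mathbb N\cup\{\infty\}$: the vectors $(Q_{\mathbf i},N_{\mathbf i},C_{(\mathbf i,1)},C_{(\mathbf i,2)},\dots)$, $\mathbf i\in U$, are i.i.d. copies of the generic vector. - Weighted branching tree with generic branching vector $(Q,N,C)$, $N\in\mathbb N$: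 the vectors $(Q_{\mathbf i},N_{\mathbf i},C_{\mathbf i})$, $\mathbf i\in U$, are i.i.d. copies of the generic vector (so $C_{\mathbf i}$ may depend on $(Q_{\mathbf i},N_{\mathbf i})$). Case 1. For each $n$, $R^{(n,k)}$ denotes $R^{(k)}$ built on the weighted branching process with generic vector $(Q^{(n)},N^{(n)},C^{(n)}_1,C^{(n)}_2,\dots)$; $\mu_n$ is the law of $(Q^{(n)},C^{(n)}_11(N^{(n)}\ge1),C^{(n)}_21(N^{(n)}\ge2),\dots)$. The limit process $R^{(k)}$ is built on the weighted branching process with generic vector $(Q,N,C_1,C_2,\dots)$, and $\mu$ is the law of $(Q,C_11(N\ge1),C_21(N\ge2),\dots)$. Here $\rho=E[\sum_{i=1}^N|C_i|]$. Case 2. For each $n$, $R^{(n,k)}$ denotes $R^{(k)}$ built on the weighted branching tree with generic vector $(Q^{(n)},N^{(n)},C^{(n)})$; $\mu_n$ is the law of $(C^{(n)}Q^{(n)},C^{(n)}1(N^{(n)}\ge1),C^{(n)}1(N^{(n)}\ge2),\dots)$ and $\nu_n^*$ is the law of $(Q^{(n)},N^{(n)})$. The limit $\mu$ is the law of $(CQ,C1(N\ge1),C1(N\ge2),\dots)$ for some real random variable $C$ independent of a random vector $(Q,N)$, $N\in\mathbb N$; $\nu^*$ is the law of $(Q,N)$. The limit process $R^{(k)}$ is built on the weighted branching tree with generic vector $(Q,N,C)$ with $C$ independent of $(Q,N)$; equivalently, on the weighted branching process with generic vector $(Q,N,C_1,C_2,\dots)$ where the $C_i$ are i.i.d. copies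 of $C$ independent of $(Q,N)$. Here $\rho=E[N|C|]=E[N]E[|C|]$. *)

theory Defs
  imports "HOL-Probability.Probability"
begin

text \<open>
  The Kantorovich-Rubinstein distance. The $\ell_1$ norm is passed as an extended nonnegative
  function. The space $\ell_1$ is treated as a subset of the space of all real sequences with the
  product topology: $\ell_1$ is separable and its norm is measurable in the coordinates, so its
  Borel sets are the traces of the product Borel sets, and a measure on sequences with finite first
  moment is concentrated on $\ell_1$ (lemma \<open>finite_first_moment_l1_seq\<close>).
\<close>

definition l1_real :: "real \<Rightarrow> ennreal" where
  "l1_real x = ennreal \<bar>x\<bar>"

definition l1_pair :: "real \<times> real \<Rightarrow> ennreal" where
  "l1_pair x = ennreal (\<bar>fst x\<bar> + \<bar>snd x\<bar>)"

definition l1_seq :: "(nat \<Rightarrow> real) \<Rightarrow> ennreal" where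
  "l1_seq x = (\<Sum>r. ennreal \<bar>x r\<bar>)"

definition couplings :: "'a measure \<Rightarrow> 'b measure \<Rightarrow> ('a \<times> 'b) measure set" where
  "couplings \<mu> \<nu> =
    {\<pi>. sets \<pi> = sets (\<mu> \<Otimes>\<^sub>M \<nu>) \<and> distr \<pi> \<mu> fst = \<mu> \<and> distr \<pi> \<nu> snd = \<nu>}"

definition kr_dist :: "('a::minus \<Rightarrow> ennreal) \<Rightarrow> 'a measure \<Rightarrow> 'a measure \<Rightarrow> ennreal" where
  "kr_dist nrm \<mu> \<nu> = (INF \<pi>\<in>couplings \<mu> \<nu>. \<integral>\<^sup>+ z. nrm (fst z - snd z) \<partial>\<pi>)"

definition finite_first_moment ::
  "('a::topological_space \<Rightarrow> ennreal) \<Rightarrow> 'a measure \<Rightarrow> bool" where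
  "finite_first_moment nrm \<mu> \<longleftrightarrow>
     prob_space \<mu> \<and> sets \<mu> = sets borel \<and> (\<integral>\<^sup>+ x. nrm x \<partial>\<mu>) < \<infinity>"

definition kr_tendsto ::
  "('a::{topological_space, minus} \<Rightarrow> ennreal) \<Rightarrow> (nat \<Rightarrow> 'a measure) \<Rightarrow> 'a measure \<Rightarrow> bool" where
  "kr_tendsto nrm \<mu> \<nu> \<longleftrightarrow>
     (\<forall>n. finite_first_moment nrm (\<mu> n)) \<and> finite_first_moment nrm \<nu> \<and>
     (\<lambda>n. kr_dist nrm (\<mu> n) \<nu>) \<longlonglongrightarrow> 0"

lemma finite_first_moment_l1_seq:
  assumes "finite_first_moment l1_seq \<mu>"
  shows "AE x in \<mu>. summable (\<lambda>r. \<bar>x r\<bar>)"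
proof -
  have s: "sets \<mu> = sets borel" and f: "(\<integral>\<^sup>+ x. l1_seq x \<partial>\<mu>) \<noteq> \<infinity>"
    using assms by (auto simp: finite_first_moment_def)
  have c: "(\<lambda>x::nat \<Rightarrow> real. x r) \<in> borel_measurable \<mu>" for r
    unfolding measurable_cong_sets[OF s refl]
    by (intro borel_measurable_continuous_onI) (auto intro: continuous_on_product_coordinates)
  have "l1_seq \<in> borel_measurable \<mu>"
    unfolding l1_seq_def [abs_def] using c by measurable
  from nn_integral_PInf_AE[OF this f]
  show ?thesis
  proof eventually_elim
    case (elim x)
    then show ?case
      by (intro summable_suminf_not_top) (auto simp: l1_seq_def)
  qed
qed


text \<open>
  Nodes of the Ulam-Harris tree are lists of positive labels; the concatenation of \<open>i\<close> and \<open>r\<close> is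
  \<open>i @ [r]\<close>. The quantities below are defined for one realization of the marks.
\<close>

definition nodes :: "nat list set" where
  "nodes = lists {1..}"

fun generation :: "(nat list \<Rightarrow> enat) \<Rightarrow> nat \<Rightarrow> nat list set" where
  "generation N 0 = {[]}"
| "generation N (Suc n) = {i @ [r] | i r. i \<in> generation N n \<and> 1 \<le> r \<and> enat r \<le> N i}"

function weight :: "(nat list \<Rightarrow> real) \<Rightarrow> nat list \<Rightarrow> real" where
  "weight C i = (if i = [] then 1 else C i * weight C (butlast i))"
  by auto
termination
  by (relation "Wellfounded.measure (\<lambda>(C, i). length i)") auto

declare weight.simps [simp del]

lemma weight_Nil [simp]: "weight C [] = 1"
  by (simp add: weight.simps)

lemma weight_snoc [simp]: "weight C (i @ [r]) = C (i @ [r]) * weight C i"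
  by (subst weight.simps) simp

text \<open>
  A generation can be infinite, since \<open>N = \<infinity>\<close> is allowed; the sum over it is unordered.
\<close>

definition generation_sum ::
  "(nat list \<Rightarrow> real) \<Rightarrow> (nat list \<Rightarrow> enat) \<Rightarrow> (nat list \<Rightarrow> real) \<Rightarrow> nat \<Rightarrow> real" where
  "generation_sum Q N C j = (\<Sum>\<^sub>\<infinity>i\<in>generation N j. Q i * weight C i)"

definition R_upto ::
  "(nat list \<Rightarrow> 'a \<Rightarrow> real) \<Rightarrow> (nat list \<Rightarrow> 'a \<Rightarrow> enat) \<Rightarrow> (nat list \<Rightarrow> 'a \<Rightarrow> real) \<Rightarrow>
   nat \<Rightarrow> 'a \<Rightarrow> real" where
  "R_upto Q N C k \<omega> =
     (\<Sum>j\<le>k. generation_sum (\<lambda>i. Q i \<omega>) (\<lambda>i. N i \<omega>) (\<lambda>i. C i \<omega>) j)"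

definition R_limit ::
  "(nat list \<Rightarrow> 'a \<Rightarrow> real) \<Rightarrow> (nat list \<Rightarrow> 'a \<Rightarrow> enat) \<Rightarrow> (nat list \<Rightarrow> 'a \<Rightarrow> real) \<Rightarrow>
   'a \<Rightarrow> real" where
  "R_limit Q N C \<omega> =
     (\<Sum>j. generation_sum (\<lambda>i. Q i \<omega>) (\<lambda>i. N i \<omega>) (\<lambda>i. C i \<omega>) j)"


text \<open>
  Weighted branching processes. A generic branching vector $(Q, N, C_1, C_2, \dots)$ enters only
  through its law \<open>D\<close>. The weight \<open>C (i @ [r])\<close> belongs to the vector of the parent \<open>i\<close>.
\<close>

definition wbp_space :: "(real \<times> enat \<times> (nat \<Rightarrow> real)) measure" where
  "wbp_space = borel \<Otimes>\<^sub>M count_space UNIV \<Otimes>\<^sub>M PiM {1..} (\<lambda>_. borel)"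

definition wbp_vector ::
  "(nat list \<Rightarrow> 'a \<Rightarrow> real) \<Rightarrow> (nat list \<Rightarrow> 'a \<Rightarrow> enat) \<Rightarrow> (nat list \<Rightarrow> 'a \<Rightarrow> real) \<Rightarrow>
   nat list \<Rightarrow> 'a \<Rightarrow> real \<times> enat \<times> (nat \<Rightarrow> real)" where
  "wbp_vector Q N C i \<omega> = (Q i \<omega>, N i \<omega>, \<lambda>r\<in>{1..}. C (i @ [r]) \<omega>)"

definition weighted_branching_process ::
  "'a measure \<Rightarrow> (real \<times> enat \<times> (nat \<Rightarrow> real)) measure \<Rightarrow> (nat list \<Rightarrow> 'a \<Rightarrow> real) \<Rightarrow>
   (nat list \<Rightarrow> 'a \<Rightarrow> enat) \<Rightarrow> (nat list \<Rightarrow> 'a \<Rightarrow> real) \<Rightarrow> bool" where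
  "weighted_branching_process M D Q N C \<longleftrightarrow>
     prob_space M \<and>
     prob_space.indep_vars M (\<lambda>_. wbp_space) (wbp_vector Q N C) nodes \<and>
     (\<forall>i\<in>nodes. distr M wbp_space (wbp_vector Q N C i) = D)"

text \<open>The law of $(Q, C_1 1(N \ge 1), C_2 1(N \ge 2), \dots)$; coordinate \<open>0\<close> carries \<open>Q\<close>.\<close>

definition wbp_mu :: "(real \<times> enat \<times> (nat \<Rightarrow> real)) measure \<Rightarrow> (nat \<Rightarrow> real) measure" where
  "wbp_mu D = distr D borel
     (\<lambda>(q, m, c) r. if r = 0 then q else if enat r \<le> m then c r else 0)"

definition wbp_rho :: "(real \<times> enat \<times> (nat \<Rightarrow> real)) measure \<Rightarrow> ennreal" where
  "wbp_rho D = (\<integral>\<^sup>+ (q, m, c). (\<Sum>r. if enat (Suc r) \<le> m then ennreal \<bar>c (Suc r)\<bar> else 0) \<partial>D)"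


text \<open>
  Weighted branching trees. The offspring numbers take values in \<open>enat\<close> only to share the tree
  construction above; they are finite, and the generic vector $(Q, N, C)$, again given by its law
  \<open>E\<close>, has a natural number as its second component.
\<close>

definition wbt_space :: "(real \<times> nat \<times> real) measure" where
  "wbt_space = borel \<Otimes>\<^sub>M count_space UNIV \<Otimes>\<^sub>M borel"

definition wbt_vector ::
  "(nat list \<Rightarrow> 'a \<Rightarrow> real) \<Rightarrow> (nat list \<Rightarrow> 'a \<Rightarrow> enat) \<Rightarrow> (nat list \<Rightarrow> 'a \<Rightarrow> real) \<Rightarrow>
   nat list \<Rightarrow> 'a \<Rightarrow> real \<times> nat \<times> real" where
  "wbt_vector Q N C i \<omega> = (Q i \<omega>, the_enat (N i \<omega>), C i \<omega>)"

definition weighted_branching_tree ::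
  "'a measure \<Rightarrow> (real \<times> nat \<times> real) measure \<Rightarrow> (nat list \<Rightarrow> 'a \<Rightarrow> real) \<Rightarrow>
   (nat list \<Rightarrow> 'a \<Rightarrow> enat) \<Rightarrow> (nat list \<Rightarrow> 'a \<Rightarrow> real) \<Rightarrow> bool" where
  "weighted_branching_tree M E Q N C \<longleftrightarrow>
     prob_space M \<and>
     (\<forall>i\<in>nodes. \<forall>\<omega>\<in>space M. N i \<omega> \<noteq> \<infinity>) \<and>
     prob_space.indep_vars M (\<lambda>_. wbt_space) (wbt_vector Q N C) nodes \<and>
     (\<forall>i\<in>nodes. distr M wbt_space (wbt_vector Q N C i) = E)"

text \<open>The law of $(CQ, C 1(N \ge 1), C 1(N \ge 2), \dots)$; coordinate \<open>0\<close> carries $CQ$.\<close>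

definition wbt_mu :: "(real \<times> nat \<times> real) measure \<Rightarrow> (nat \<Rightarrow> real) measure" where
  "wbt_mu E = distr E borel
     (\<lambda>(q, m, c) r. if r = 0 then c * q else if r \<le> m then c else 0)"

definition wbt_nu :: "(real \<times> nat \<times> real) measure \<Rightarrow> (real \<times> real) measure" where
  "wbt_nu E = distr E borel (\<lambda>(q, m, c). (q, real m))"

definition wbt_rho :: "(real \<times> nat \<times> real) measure \<Rightarrow> ennreal" where
  "wbt_rho E = (\<integral>\<^sup>+ (q, m, c). ennreal (real m * \<bar>c\<bar>) \<partial>E)"

text \<open>
  Independence of \<open>C\<close> and \<open>(Q, N)\<close> under \<open>E\<close>, i.e. of the generated sigma-algebras; the library
  constant \<open>indep_var\<close> requires both variables to have the same type.
\<close>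

definition weight_indep :: "(real \<times> nat \<times> real) measure \<Rightarrow> bool" where
  "weight_indep E \<longleftrightarrow>
     prob_space.indep_set E
       {(\<lambda>(q, m, c). c) -` A \<inter> space E | A. A \<in> sets borel}
       {(\<lambda>(q, m, c). (q, m)) -` B \<inter> space E | B. B \<in> sets (borel \<Otimes>\<^sub>M count_space UNIV)}"

end

theory Submission
  imports Defs
begin

text \<open>
  Give the node \<open>i\<close> the mark sequence \<open>y_i = (Q_i, C_(i,1) 1(N_i \<ge> 1), C_(i,2) 1(N_i \<ge> 2), \<dots>)\<close> in Case 1
  and \<open>y_i = (C_i Q_i, C_i 1(N_i \<ge> 1), C_i 1(N_i \<ge> 2), \<dots>)\<close> in Case 2, where \<open>C_i\<close> is replaced by \<open>1\<close> at
  the root. In both cases the term of \<open>i\<close> in \<open>R^(k)\<close> is \<open>y_i(0)\<close> times the product of the entries of the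
  marks of the strict ancestors along the path to \<open>i\<close>, and it vanishes off the tree. The marks are
  independent, with one law at the root and one law elsewhere; couplings of these laws, used
  independently at all nodes, couple \<open>R^(n,k)\<close> with \<open>R^(k)\<close>. Write \<open>b_j\<close> and \<open>w_j\<close> for the sums over level \<open>j\<close>
  of the expected difference of the path weights and of the expected absolute path weights of the limit. As
  a mark is independent of the path weight leading to it, \<open>w_(j+1) \<le> \<rho> w_j\<close> and
  \<open>b_(j+1) \<le> (\<rho> + e) b_j + e w_j\<close> with \<open>e\<close> the cost of the coupling. Hence every \<open>b_j\<close> tends to \<open>0\<close> with the
  costs, and for \<open>\<rho> < 1\<close> even \<open>\<Sum>_j b_j\<close> does.
\<close>

section \<open>Unordered sums, product measures and sequences\<close>

text \<open>For real functions, unordered summability and integrability against counting measure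
  both mean absolute summability, and both operators return 0 otherwise. The identity therefore
  holds unconditionally and opens up measurability and Tonelli arguments.\<close>

lemma infsum_eq_lebesgue_integral:
  fixes f :: "'a \<Rightarrow> real"
  shows "infsum f A = (LINT i|count_space A. f i)"
proof (cases "integrable (count_space A) f")
  case True
  then show ?thesis
    using infsetsum_infsum[of f A]
    by (simp add: Infinite_Set_Sum.abs_summable_on_def infsetsum_def)
next
  case False
  then have "\<not> f summable_on A"
    by (metis abs_summable_equivalent Infinite_Set_Sum.abs_summable_on_def
        summable_on_iff_abs_summable_on_real)
  with False show ?thesis
    by (simp add: infsum_not_exists not_integrable_integral_eq)
qed

text \<open>If \<open>f - g\<close> is not integrable, the right-hand side is infinite. If it is,
  then \<open>f\<close> and \<open>g\<close> are integrable together or not at all, and in the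
  latter case both sums have the default value 0.\<close>

lemma abs_infsum_diff_le:
  fixes f g :: "'a \<Rightarrow> real"
  shows "ennreal \<bar>infsum f A - infsum g A\<bar> \<le> (\<integral>\<^sup>+i. ennreal \<bar>f i - g i\<bar> \<partial>count_space A)"
proof (cases "integrable (count_space A) (\<lambda>i. f i - g i)")
  case False
  then have "(\<integral>\<^sup>+i. ennreal \<bar>f i - g i\<bar> \<partial>count_space A) = \<infinity>"
    by (simp add: integrable_iff_bounded less_top[symmetric])
  then show ?thesis by simp
next
  case True
  have iff: "integrable (count_space A) f \<longleftrightarrow> integrable (count_space A) g"
  proof
    assume "integrable (count_space A) f"
    from Bochner_Integration.integrable_diff[OF this True]
    show "integrable (count_space A) g" by simp
  next
    assume "integrable (count_space A) g"
    from Bochner_Integration.integrable_add[OF this True]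
    show "integrable (count_space A) f" by simp
  qed
  show ?thesis
  proof (cases "integrable (count_space A) f")
    case f: True
    then have "infsum f A - infsum g A = (LINT i|count_space A. f i - g i)"
      using iff by (simp add: infsum_eq_lebesgue_integral)
    then show ?thesis
      using integral_norm_bound_ennreal[OF True] by simp
  next
    case False
    then show ?thesis
      using iff by (simp add: infsum_eq_lebesgue_integral not_integrable_integral_eq)
  qed
qed

text \<open>The sum is a parametrised integral against a sigma-finite counting measure, whose
  measurability includes the points where the series diverges and the value is 0.\<close>

lemma borel_measurable_infsum:
  fixes f :: "'a \<Rightarrow> 'b \<Rightarrow> real"
  assumes A: "countable A" and f: "\<And>i. i \<in> A \<Longrightarrow> f i \<in> borel_measurable M"
  shows "(\<lambda>x. infsum (\<lambda>i. f i x) A) \<in> borel_measurable M"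
proof -
  interpret sigma_finite_measure "count_space A"
    by (rule sigma_finite_measure_count_space_countable[OF A])
  have "(\<lambda>(x, i). f i x) \<in> borel_measurable (M \<Otimes>\<^sub>M count_space A)"
  proof -
    have "(\<lambda>(i, x). f i x) \<in> borel_measurable (count_space A \<Otimes>\<^sub>M M)"
      by (rule measurable_pair_measure_countable1[OF A]) (simp add: f)
    from measurable_pair_swap[OF this] show ?thesis
      by (simp only: prod.case)
  qed
  then show ?thesis
    unfolding infsum_eq_lebesgue_integral
    by (rule borel_measurable_lebesgue_integral)
qed

section \<open>Coordinatewise images and resampling in infinite products\<close>

text \<open>Finite measures on the product sigma-algebra are determined by finite-dimensional
  cylinders, and a coordinatewise map pulls cylinders back to cylinders.\<close>

lemma PiM_distr_component:
  assumes K: "\<And>i. i \<in> I \<Longrightarrow> prob_space (K i)"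
    and f [measurable]: "\<And>i. i \<in> I \<Longrightarrow> f i \<in> K i \<rightarrow>\<^sub>M S i"
  shows "distr (PiM I K) (PiM I S) (\<lambda>z. \<lambda>i\<in>I. f i (z i)) = PiM I (\<lambda>i. distr (K i) (S i) (f i))"
    (is "?L = ?R")
proof (rule measure_eqI_PiM_infinite[where M = "\<lambda>i. distr (K i) (S i) (f i)", symmetric])
  have P: "prob_space (distr (K i) (S i) (f i))" if "i \<in> I" for i
    using K[OF that] f[OF that] by (intro prob_space.prob_space_distr)
  then interpret R: prob_space ?R
    by (intro prob_space_PiM)
  show "finite_measure ?R"
    by unfold_locales
  show "sets ?L = sets ?R"
    by (auto intro!: sets_PiM_cong)
  fix A J
  assume J: "finite J" "J \<subseteq> I" and A: "\<And>i. i \<in> J \<Longrightarrow> A i \<in> sets (distr (K i) (S i) (f i))"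
  let ?E = "prod_emb I (\<lambda>i. distr (K i) (S i) (f i)) J (Pi\<^sub>E J A)"
  let ?g = "\<lambda>z. \<lambda>i\<in>I. f i (z i)"
  have g: "?g \<in> PiM I K \<rightarrow>\<^sub>M PiM I S"
    by (intro measurable_restrict) (auto intro: measurable_compose[OF measurable_component_singleton[where I = I and M = K]] f)
  have E: "?E = prod_emb I S J (Pi\<^sub>E J A)"
    by (auto simp: prod_emb_def)
  have B: "f j -` A j \<inter> space (K j) \<in> sets (K j)" if "j \<in> J" for j
    using A[OF that] f that J by (auto intro!: measurable_sets[of "f j" "K j" "S j"])
  have "?R ?E = (\<Prod>j\<in>J. distr (K j) (S j) (f j) (A j))"
    using J A P by (intro emeasure_PiM_emb) auto
  also have "\<dots> = (\<Prod>j\<in>J. K j (f j -` A j \<inter> space (K j)))"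
    using J A by (intro prod.cong refl emeasure_distr f) auto
  also have "\<dots> = PiM I K (prod_emb I K J (\<Pi>\<^sub>E j\<in>J. f j -` A j \<inter> space (K j)))"
    using J B K by (intro emeasure_PiM_emb[symmetric]) auto
  \<comment> \<open>Coordinates outside \<open>J\<close> impose no condition on either side, because
    each \<open>f i\<close> maps into the space of \<open>S i\<close>.\<close>
  also have "prod_emb I K J (\<Pi>\<^sub>E j\<in>J. f j -` A j \<inter> space (K j)) = ?g -` ?E \<inter> space (PiM I K)"
  proof -
    have "f i u \<in> space (S i)" if "i \<in> I" "u \<in> space (K i)" for i u
      using measurable_space[OF f] that by blast
    then show ?thesis
      using J by (auto simp: prod_emb_def space_PiM PiE_iff subset_eq) 
  qed
  also have "PiM I K \<dots> = ?L ?E"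
    unfolding E using J A by (intro emeasure_distr[symmetric] g sets_PiM_I) auto
  finally show "?R ?E = ?L ?E" .
qed simp

text \<open>Overwriting coordinate \<open>i\<close> by a fresh draw from \<open>K i\<close>
  preserves the product measure. Since \<open>g\<close> does not see that coordinate,
  \<open>f\<close> and \<open>g\<close> then live on different factors of
  \<open>K i \<Otimes>\<^sub>M PiM I K\<close>.\<close>

lemma nn_integral_PiM_resample:
  assumes K: "\<And>i. i \<in> I \<Longrightarrow> prob_space (K i)" and i: "i \<in> I"
    and f [measurable]: "f \<in> borel_measurable (K i)"
    and g [measurable]: "g \<in> borel_measurable (PiM I K)"
    and inv: "\<And>z u. z \<in> space (PiM I K) \<Longrightarrow> u \<in> space (K i) \<Longrightarrow> g (z(i := u)) = g z"
  shows "(\<integral>\<^sup>+z. f (z i) * g z \<partial>PiM I K) = (\<integral>\<^sup>+u. f u \<partial>K i) * (\<integral>\<^sup>+z. g z \<partial>PiM I K)"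
proof -
  interpret Z: prob_space "PiM I K" by (intro prob_space_PiM K)
  interpret Ki: prob_space "K i" by (rule K[OF i])
  have ins [simp]: "insert i I = I" using i by auto
  \<comment> \<open>Adjoining coordinate \<open>i\<close> to the index set \<open>I\<close> changes
    nothing as \<open>i \<in> I\<close>, so the extension rule for products becomes invariance under
    resampling.\<close>
  have eq: "distr (K i \<Otimes>\<^sub>M PiM I K) (PiM I K) (\<lambda>(x, X). X(i := x)) = PiM I K"
    using distr_pair_PiM_eq_PiM[of I K i] K i by simp
  have m: "(\<lambda>(x, X). X(i := x)) \<in> K i \<Otimes>\<^sub>M PiM I K \<rightarrow>\<^sub>M PiM I K"
    unfolding case_prod_beta'
    by (rule measurable_fun_upd[where J = I, OF _ measurable_snd measurable_fst]) simp
  have ki: "(\<lambda>z. f (z i)) \<in> borel_measurable (PiM I K)"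
    using measurable_compose[OF measurable_component_singleton[OF i, of K] f] .
  have "(\<integral>\<^sup>+z. f (z i) * g z \<partial>PiM I K)
      = (\<integral>\<^sup>+z. f (z i) * g z \<partial>distr (K i \<Otimes>\<^sub>M PiM I K) (PiM I K) (\<lambda>(x, X). X(i := x)))"
    by (simp add: eq)
  also have "\<dots> = (\<integral>\<^sup>+p. f (fst p) * g ((snd p)(i := fst p)) \<partial>(K i \<Otimes>\<^sub>M PiM I K))"
    using m ki by (subst nn_integral_distr) (auto simp: case_prod_beta')
  also have "\<dots> = (\<integral>\<^sup>+p. f (fst p) * g (snd p) \<partial>(K i \<Otimes>\<^sub>M PiM I K))"
    using inv by (intro nn_integral_cong) (auto simp: space_pair_measure)
  also have "\<dots> = (\<integral>\<^sup>+u. \<integral>\<^sup>+z. f u * g z \<partial>PiM I K \<partial>K i)"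
    by (subst Z.nn_integral_fst[symmetric]) (auto simp: case_prod_beta')
  finally show ?thesis
    by (simp add: nn_integral_cmult nn_integral_multc)
qed

section \<open>Real sequences and partial l1 norms\<close>

lemma measurable_seq_coordinate [measurable]:
  "(\<lambda>x. x r) \<in> borel_measurable (borel :: (nat \<Rightarrow> real) measure)"
  by (intro borel_measurable_continuous_onI continuous_on_product_coordinates)

text \<open>The index set is countable, so the Borel sets of the product topology form the product
  sigma-algebra.\<close>

lemma measurable_seqI:
  fixes f :: "'a \<Rightarrow> nat \<Rightarrow> real"
  assumes "\<And>r. (\<lambda>x. f x r) \<in> borel_measurable M"
  shows "f \<in> borel_measurable M"
proof -
  have "f \<in> M \<rightarrow>\<^sub>M PiM UNIV (\<lambda>_. borel)"
    using assms by (intro measurable_PiM_single') auto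
  then show ?thesis
    by (simp add: measurable_cong_sets[OF refl sets_PiM_equal_borel])
qed

text \<open>The set \<open>S\<close> separates the roles of the coordinates of a mark:
  \<open>{0}\<close> is the additive term of the node, \<open>{1..}\<close> are the weights handed
  to its children, and \<open>UNIV\<close> gives the full l1 norm.\<close>

definition coord_mass :: "nat set \<Rightarrow> (nat \<Rightarrow> real) \<Rightarrow> ennreal" where
  "coord_mass S x = (\<integral>\<^sup>+r. ennreal \<bar>x r\<bar> \<partial>count_space S)"

lemma coord_mass_UNIV: "coord_mass UNIV x = l1_seq x"
  by (simp add: coord_mass_def l1_seq_def nn_integral_count_space_nat)

lemma coord_mass_le_l1_seq: "coord_mass S x \<le> l1_seq x"
proof -
  have "coord_mass S x = (\<integral>\<^sup>+r. ennreal \<bar>x r\<bar> * indicator S r \<partial>count_space UNIV)"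
    by (simp add: coord_mass_def nn_integral_count_space_indicator)
  also have "\<dots> \<le> coord_mass UNIV x"
    unfolding coord_mass_def by (intro nn_integral_mono) (simp add: indicator_def)
  finally show ?thesis
    by (simp add: coord_mass_UNIV)
qed

lemma coord_mass_triangle: "coord_mass S x \<le> coord_mass S y + coord_mass S (x - y)"
  unfolding coord_mass_def
  by (subst nn_integral_add[symmetric])
     (auto intro!: nn_integral_mono simp: ennreal_plus[symmetric] simp del: ennreal_plus)

lemma borel_measurable_coord_mass [measurable]: "coord_mass S \<in> borel_measurable borel"
proof -
  have "coord_mass S = (\<lambda>x. \<Sum>r. ennreal \<bar>x r\<bar> * indicator S r)"
    by (simp add: fun_eq_iff coord_mass_def nn_integral_count_space_indicator nn_integral_count_space_nat)
  then show ?thesis by simp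
qed

lemma borel_measurable_l1_seq [measurable]: "l1_seq \<in> borel_measurable borel"
  using borel_measurable_coord_mass[of UNIV] by (simp add: coord_mass_UNIV [abs_def])

section \<open>Path weights and their moments\<close>

text \<open>Levels of the full tree are deterministic index sets, in contrast to the random
  generations; nodes off the realised tree will carry vanishing path weights.\<close>

definition level :: "nat \<Rightarrow> nat list set" where
  "level j = {i \<in> nodes. length i = j}"

lemma nodes_Nil [simp]: "[] \<in> nodes"
  by (simp add: nodes_def)

lemma nodes_snoc [simp]: "i @ [r] \<in> nodes \<longleftrightarrow> i \<in> nodes \<and> 1 \<le> r"
  by (auto simp: nodes_def)

lemma take_in_nodes: "i \<in> nodes \<Longrightarrow> take l i \<in> nodes"
  by (auto simp: nodes_def dest: in_set_takeD)

lemma level_0 [simp]: "level 0 = {[]}"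
  by (auto simp: level_def)

lemma level_in_nodes: "i \<in> level j \<Longrightarrow> i \<in> nodes"
  by (simp add: level_def)

lemma level_Suc_Nil: "i \<in> level (Suc j) \<Longrightarrow> i \<noteq> []"
  by (auto simp: level_def)

lemma countable_level [simp]: "countable (level j)"
  by (rule countableI_type)

lemma bij_betw_level_Suc:
  "bij_betw (\<lambda>(i, r). i @ [r]) (level j \<times> {1..}) (level (Suc j))"
proof (rule bij_betw_imageI)
  show "inj_on (\<lambda>(i, r). i @ [r]) (level j \<times> {1..})"
    by (auto simp: inj_on_def)
  have "i \<in> (\<lambda>(i, r). i @ [r]) ` (level j \<times> {1..})" if "i \<in> level (Suc j)" for i
    using that by (cases i rule: rev_cases) (auto simp: level_def image_iff)
  then show "(\<lambda>(i, r). i @ [r]) ` (level j \<times> {1..}) = level (Suc j)"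
    by (auto simp: level_def)
qed

text \<open>Every node of the next level is uniquely a node of this level followed by a positive
  label; Tonelli for counting measures does the rest. All recursions over levels start from this
  identity.\<close>

lemma nn_integral_level_Suc:
  "(\<integral>\<^sup>+i. h i \<partial>count_space (level (Suc j)))
    = (\<integral>\<^sup>+i. \<integral>\<^sup>+r. h (i @ [r]) \<partial>count_space {1..} \<partial>count_space (level j))"
proof -
  have "(\<integral>\<^sup>+i. h i \<partial>count_space (level (Suc j)))
      = (\<integral>\<^sup>+p. h (fst p @ [snd p]) \<partial>count_space (level j \<times> {1..}))"
    by (subst nn_integral_bij_count_space[OF bij_betw_level_Suc, symmetric])
       (simp add: case_prod_beta')
  also have "\<dots> = (\<integral>\<^sup>+p. h (fst p @ [snd p]) * indicator {1..} (snd p) * indicator (level j) (fst p)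
      \<partial>count_space UNIV)"
    by (subst nn_integral_count_space_indicator)
       (auto intro!: nn_integral_cong simp: indicator_def)
  also have "\<dots> = (\<integral>\<^sup>+i. \<integral>\<^sup>+r. h (i @ [r]) * indicator {1..} r * indicator (level j) i
      \<partial>count_space UNIV \<partial>count_space UNIV)"
    by (subst nn_integral_fst_count_space[symmetric]) simp
  also have "\<dots> = (\<integral>\<^sup>+i. (\<integral>\<^sup>+r. h (i @ [r]) * indicator {1..} r \<partial>count_space UNIV) * indicator (level j) i
      \<partial>count_space UNIV)"
    by (intro nn_integral_cong nn_integral_multc) simp
  finally show ?thesis
    by (simp add: nn_integral_count_space_indicator)
qed

text \<open>The strict ancestor \<open>take l i\<close> contributes the entry of its mark at
  \<open>i ! l\<close>, the label by which the path leaves it. The mark at \<open>i\<close> itself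
  does not enter.\<close>

definition path_weight :: "(nat list \<Rightarrow> nat \<Rightarrow> real) \<Rightarrow> nat list \<Rightarrow> real" where
  "path_weight y i = (\<Prod>l<length i. y (take l i) (i ! l))"

lemma path_weight_Nil [simp]: "path_weight y [] = 1"
  by (simp add: path_weight_def)

lemma path_weight_snoc [simp]: "path_weight y (i @ [r]) = y i r * path_weight y i"
  by (simp add: path_weight_def nth_append mult.commute)

lemma path_weight_cong:
  "(\<And>l. l < length i \<Longrightarrow> y (take l i) = y' (take l i)) \<Longrightarrow> path_weight y i = path_weight y' i"
  by (simp add: path_weight_def)

definition level_sum :: "(nat list \<Rightarrow> nat \<Rightarrow> real) \<Rightarrow> nat \<Rightarrow> real" where
  "level_sum y j = (\<Sum>\<^sub>\<infinity>i\<in>level j. y i 0 * path_weight y i)"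

definition tree_sum :: "nat \<Rightarrow> (nat list \<Rightarrow> nat \<Rightarrow> real) \<Rightarrow> real" where
  "tree_sum k y = (\<Sum>j\<le>k. level_sum y j)"

definition tree_limit :: "(nat list \<Rightarrow> nat \<Rightarrow> real) \<Rightarrow> real" where
  "tree_limit y = (\<Sum>j. level_sum y j)"

text \<open>Ancestors of nodes are nodes, so marks on other lists are never read. This lets
  arbitrary families be exchanged for the extensional functions that make up the product
  space.\<close>

lemma level_sum_restrict: "level_sum (restrict y nodes) j = level_sum y j"
  unfolding level_sum_def
  by (intro infsum_cong arg_cong2[where f = "(*)"] path_weight_cong)
     (auto simp: level_def take_in_nodes)

lemma tree_sum_restrict: "tree_sum k (restrict y nodes) = tree_sum k y"
  by (simp add: tree_sum_def level_sum_restrict)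

lemma tree_limit_restrict: "tree_limit (restrict y nodes) = tree_limit y"
  by (simp add: tree_limit_def level_sum_restrict)

lemma borel_measurable_node_coordinate:
  "i \<in> nodes \<Longrightarrow>
    (\<lambda>y. y i r) \<in> borel_measurable (PiM nodes (\<lambda>_. borel :: (nat \<Rightarrow> real) measure))"
  using measurable_compose[OF measurable_component_singleton[of i nodes "\<lambda>_. borel"]
      measurable_seq_coordinate[of r]] .

lemma borel_measurable_level_sum:
  "(\<lambda>y. level_sum y j) \<in> borel_measurable (PiM nodes (\<lambda>_. borel))"
  unfolding level_sum_def path_weight_def
  by (intro borel_measurable_infsum borel_measurable_times borel_measurable_prod
        borel_measurable_node_coordinate countable_level)
     (auto simp: level_def take_in_nodes)

lemma borel_measurable_tree_sum [measurable]:
  "tree_sum k \<in> borel_measurable (PiM nodes (\<lambda>_. borel))"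
  unfolding tree_sum_def [abs_def] using borel_measurable_level_sum by measurable

lemma borel_measurable_tree_limit [measurable]:
  "tree_limit \<in> borel_measurable (PiM nodes (\<lambda>_. borel))"
  unfolding tree_limit_def [abs_def] using borel_measurable_level_sum by measurable


section \<open>Independent marks and moment recursions over the levels\<close>

text \<open>The type of sample points is left open so that one sample can be a coupled pair of
  marks; markings \<open>x\<close> and \<open>y\<close> read two mark sequences from the same
  sample.\<close>

locale marked_tree =
  fixes K :: "nat list \<Rightarrow> 'c measure"
  assumes prob_K: "\<And>i. prob_space (K i)"
begin

abbreviation Z :: "(nat list \<Rightarrow> 'c) measure" where
  "Z \<equiv> PiM nodes K"

definition marking :: "('c \<Rightarrow> nat \<Rightarrow> real) \<Rightarrow> bool" where
  "marking x \<longleftrightarrow> (\<forall>i. x \<in> borel_measurable (K i))"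

text \<open>For the limit marking this is the quantity \<open>w_j\<close> of the introduction, and
  \<open>weight_gap\<close> below is \<open>b_j\<close>. Both are sums of expectations over the full
  level.\<close>

definition mean_weight :: "('c \<Rightarrow> nat \<Rightarrow> real) \<Rightarrow> nat \<Rightarrow> ennreal" where
  "mean_weight x j =
    (\<integral>\<^sup>+i. \<integral>\<^sup>+z. ennreal \<bar>path_weight (\<lambda>j. x (z j)) i\<bar> \<partial>Z \<partial>count_space (level j))"

definition weight_gap :: "('c \<Rightarrow> nat \<Rightarrow> real) \<Rightarrow> ('c \<Rightarrow> nat \<Rightarrow> real) \<Rightarrow> nat \<Rightarrow> ennreal" where
  "weight_gap x y j =
    (\<integral>\<^sup>+i. \<integral>\<^sup>+z. ennreal \<bar>path_weight (\<lambda>j. x (z j)) i - path_weight (\<lambda>j. y (z j)) i\<bar>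
      \<partial>Z \<partial>count_space (level j))"

lemma prob_Z: "prob_space Z"
  by (intro prob_space_PiM prob_K)

text \<open>Comparing a marking with the zero marking turns estimates of differences into moment
  bounds for a single marking.\<close>

lemma marking_zero: "marking (\<lambda>_ _. 0)"
  by (simp add: marking_def)

lemma marking_coordinate:
  assumes "marking x" "i \<in> nodes"
  shows "(\<lambda>z. x (z i) r) \<in> borel_measurable Z"
proof -
  have "x \<in> borel_measurable (K i)"
    using assms(1) by (simp add: marking_def)
  then have "(\<lambda>z. x (z i)) \<in> borel_measurable Z"
    by (rule measurable_compose[OF measurable_component_singleton[OF assms(2), of K]])
  from measurable_compose[OF this measurable_seq_coordinate] show ?thesis .
qed

lemma marking_path_weight:
  assumes "marking x" "i \<in> nodes"
  shows "(\<lambda>z. path_weight (\<lambda>j. x (z j)) i) \<in> borel_measurable Z"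
  unfolding path_weight_def
  by (intro borel_measurable_prod marking_coordinate assms take_in_nodes)

text \<open>Strict ancestors of \<open>i\<close> are shorter than \<open>i\<close>, so none of them
  is the overwritten node. This is the invariance required by
  \<open>nn_integral_PiM_resample\<close>.\<close>

lemma path_weight_resample:
  "path_weight (\<lambda>j. x ((z(i := u)) j)) i = path_weight (\<lambda>j. x (z j)) i"
proof (rule path_weight_cong)
  fix l assume "l < length i"
  then have "length (take l i) \<noteq> length i" by simp
  then have "take l i \<noteq> i" by metis
  then show "x ((z(i := u)) (take l i)) = x (z (take l i))" by simp
qed

text \<open>
  The mark at \<open>i\<close> is independent of the path weight of \<open>i\<close>, which involves only strict ancestors.
\<close>

lemma level_step:
  assumes x: "marking x" and y: "marking y"
    and A: "\<And>i. i \<in> level j \<Longrightarrow> (\<integral>\<^sup>+u. coord_mass S (x u) \<partial>K i) \<le> A"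
    and e: "\<And>i. i \<in> level j \<Longrightarrow> (\<integral>\<^sup>+u. coord_mass S (x u - y u) \<partial>K i) \<le> e"
  shows "(\<integral>\<^sup>+i. \<integral>\<^sup>+r. \<integral>\<^sup>+z. ennreal \<bar>x (z i) r * path_weight (\<lambda>j. x (z j)) i
            - y (z i) r * path_weight (\<lambda>j. y (z j)) i\<bar> \<partial>Z \<partial>count_space S \<partial>count_space (level j))
    \<le> A * weight_gap x y j + e * mean_weight y j"
proof -
  let ?px = "\<lambda>z i. path_weight (\<lambda>j. x (z j)) i" and ?py = "\<lambda>z i. path_weight (\<lambda>j. y (z j)) i"
  have node: "(\<integral>\<^sup>+r. \<integral>\<^sup>+z. ennreal \<bar>x (z i) r * ?px z i - y (z i) r * ?py z i\<bar> \<partial>Z \<partial>count_space S)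
      \<le> A * (\<integral>\<^sup>+z. ennreal \<bar>?px z i - ?py z i\<bar> \<partial>Z) + e * (\<integral>\<^sup>+z. ennreal \<bar>?py z i\<bar> \<partial>Z)"
    if i: "i \<in> level j" for i
  proof -
    have n: "i \<in> nodes" using i by (simp add: level_in_nodes)
    note [measurable] = marking_coordinate[OF x n] marking_coordinate[OF y n]
      marking_path_weight[OF x n] marking_path_weight[OF y n]
    have xi [measurable]: "x \<in> borel_measurable (K i)" and yi [measurable]: "y \<in> borel_measurable (K i)"
      using x y by (auto simp: marking_def)
    have d [measurable]: "(\<lambda>u. x u - y u) \<in> borel_measurable (K i)"
      by (rule measurable_seqI) simp
    have gx: "(\<lambda>u. coord_mass S (x u)) \<in> borel_measurable (K i)" by measurable
    have gd: "(\<lambda>u. coord_mass S (x u - y u)) \<in> borel_measurable (K i)" by measurable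
    have hx [measurable]: "(\<lambda>z. coord_mass S (x (z i))) \<in> borel_measurable Z"
      using measurable_compose[OF measurable_component_singleton[OF n, of K] gx] .
    have hd [measurable]: "(\<lambda>z. coord_mass S (x (z i) - y (z i))) \<in> borel_measurable Z"
      using measurable_compose[OF measurable_component_singleton[OF n, of K] gd] .
    have "(\<integral>\<^sup>+r. \<integral>\<^sup>+z. ennreal \<bar>x (z i) r * ?px z i - y (z i) r * ?py z i\<bar> \<partial>Z \<partial>count_space S)
        = (\<integral>\<^sup>+z. \<integral>\<^sup>+r. ennreal \<bar>x (z i) r * ?px z i - y (z i) r * ?py z i\<bar> \<partial>count_space S \<partial>Z)"
      by (rule nn_integral_count_space_nn_integral[symmetric]) auto
    also have "\<dots> \<le> (\<integral>\<^sup>+z. coord_mass S (x (z i)) * ennreal \<bar>?px z i - ?py z i\<bar>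
        + coord_mass S (x (z i) - y (z i)) * ennreal \<bar>?py z i\<bar> \<partial>Z)"
    proof (rule nn_integral_mono)
      fix z
      have "ennreal \<bar>x (z i) r * ?px z i - y (z i) r * ?py z i\<bar>
          \<le> ennreal \<bar>x (z i) r\<bar> * ennreal \<bar>?px z i - ?py z i\<bar>
            + ennreal \<bar>x (z i) r - y (z i) r\<bar> * ennreal \<bar>?py z i\<bar>" for r
      proof -
        \<comment> \<open>This splitting pairs the mark of \<open>x\<close> with the gap of the path
          weights and the gap of the marks with the path weight of \<open>y\<close>, so the path
          weights of \<open>x\<close> need no moment bound of their own.\<close>
        have "x (z i) r * ?px z i - y (z i) r * ?py z i
            = x (z i) r * (?px z i - ?py z i) + (x (z i) r - y (z i) r) * ?py z i"
          by (simp add: algebra_simps)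
        then have "\<bar>x (z i) r * ?px z i - y (z i) r * ?py z i\<bar>
            \<le> \<bar>x (z i) r\<bar> * \<bar>?px z i - ?py z i\<bar> + \<bar>x (z i) r - y (z i) r\<bar> * \<bar>?py z i\<bar>"
          by (metis abs_mult abs_triangle_ineq)
        then show ?thesis
          by (simp add: ennreal_mult[symmetric] ennreal_plus[symmetric] del: ennreal_plus)
      qed
      then have "(\<integral>\<^sup>+r. ennreal \<bar>x (z i) r * ?px z i - y (z i) r * ?py z i\<bar> \<partial>count_space S)
          \<le> (\<integral>\<^sup>+r. ennreal \<bar>x (z i) r\<bar> * ennreal \<bar>?px z i - ?py z i\<bar>
            + ennreal \<bar>x (z i) r - y (z i) r\<bar> * ennreal \<bar>?py z i\<bar> \<partial>count_space S)"
        by (rule nn_integral_mono)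
      then show "(\<integral>\<^sup>+r. ennreal \<bar>x (z i) r * ?px z i - y (z i) r * ?py z i\<bar> \<partial>count_space S)
          \<le> coord_mass S (x (z i)) * ennreal \<bar>?px z i - ?py z i\<bar>
            + coord_mass S (x (z i) - y (z i)) * ennreal \<bar>?py z i\<bar>"
        by (simp add: nn_integral_add nn_integral_multc coord_mass_def)
    qed
    also have "\<dots> = (\<integral>\<^sup>+z. coord_mass S (x (z i)) * ennreal \<bar>?px z i - ?py z i\<bar> \<partial>Z)
        + (\<integral>\<^sup>+z. coord_mass S (x (z i) - y (z i)) * ennreal \<bar>?py z i\<bar> \<partial>Z)"
      by (rule nn_integral_add) measurable
    also have "(\<integral>\<^sup>+z. coord_mass S (x (z i)) * ennreal \<bar>?px z i - ?py z i\<bar> \<partial>Z)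
        = (\<integral>\<^sup>+u. coord_mass S (x u) \<partial>K i) * (\<integral>\<^sup>+z. ennreal \<bar>?px z i - ?py z i\<bar> \<partial>Z)"
      using path_weight_resample[of x] path_weight_resample[of y]
      by (intro nn_integral_PiM_resample[where f = "\<lambda>u. coord_mass S (x u)"] prob_K n gx) simp_all
    also have "(\<integral>\<^sup>+z. coord_mass S (x (z i) - y (z i)) * ennreal \<bar>?py z i\<bar> \<partial>Z)
        = (\<integral>\<^sup>+u. coord_mass S (x u - y u) \<partial>K i) * (\<integral>\<^sup>+z. ennreal \<bar>?py z i\<bar> \<partial>Z)"
      using path_weight_resample[of y]
      by (intro nn_integral_PiM_resample[where f = "\<lambda>u. coord_mass S (x u - y u)"] prob_K n gd) simp_all
    finally show ?thesis
      using A[OF i] e[OF i] by (elim order_trans) (intro add_mono mult_right_mono; simp)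
  qed
  have "(\<integral>\<^sup>+i. \<integral>\<^sup>+r. \<integral>\<^sup>+z. ennreal \<bar>x (z i) r * ?px z i - y (z i) r * ?py z i\<bar>
        \<partial>Z \<partial>count_space S \<partial>count_space (level j))
      \<le> (\<integral>\<^sup>+i. A * (\<integral>\<^sup>+z. ennreal \<bar>?px z i - ?py z i\<bar> \<partial>Z) + e * (\<integral>\<^sup>+z. ennreal \<bar>?py z i\<bar> \<partial>Z)
        \<partial>count_space (level j))"
    by (intro nn_integral_mono node) simp
  then show ?thesis
    by (simp add: nn_integral_add nn_integral_cmult weight_gap_def mean_weight_def)
qed

lemma mean_weight_0 [simp]: "mean_weight x 0 = 1"
  using prob_space.emeasure_space_1[OF prob_Z]
  by (simp add: mean_weight_def nn_integral_count_space_finite)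

lemma weight_gap_0 [simp]: "weight_gap x y 0 = 0"
  by (simp add: weight_gap_def nn_integral_count_space_finite)

text \<open>With \<open>S = {1..}\<close> the double sum in \<open>level_step\<close> runs over all
  children of level \<open>j\<close>, and its terms are the differences of their path
  weights.\<close>

lemma weight_gap_Suc_le:
  assumes "marking x" "marking y"
    and "\<And>i. i \<in> level j \<Longrightarrow> (\<integral>\<^sup>+u. coord_mass {1..} (x u) \<partial>K i) \<le> A"
    and "\<And>i. i \<in> level j \<Longrightarrow> (\<integral>\<^sup>+u. coord_mass {1..} (x u - y u) \<partial>K i) \<le> e"
  shows "weight_gap x y (Suc j) \<le> A * weight_gap x y j + e * mean_weight y j"
  using level_step[OF assms] by (simp add: weight_gap_def[of x y "Suc j"] nn_integral_level_Suc)

lemma mean_weight_Suc_le: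
  assumes y: "marking y"
    and e: "\<And>i. i \<in> level j \<Longrightarrow> (\<integral>\<^sup>+u. coord_mass {1..} (y u) \<partial>K i) \<le> e"
  shows "mean_weight y (Suc j) \<le> e * mean_weight y j"
  using level_step[OF marking_zero y, of j "{1..}" 0 e] e
  by (simp add: mean_weight_def[of y "Suc j"] nn_integral_level_Suc coord_mass_def)

text \<open>With \<open>S = {0}\<close> the inner sum in \<open>level_step\<close> is the single
  contribution of the node to \<open>level_sum\<close>; expectation and sum over the countable level
  are exchanged first.\<close>

lemma level_sum_diff_le:
  assumes x: "marking x" and y: "marking y"
    and q: "\<And>i. i \<in> level j \<Longrightarrow> (\<integral>\<^sup>+u. coord_mass {0} (x u) \<partial>K i) \<le> q"
    and e: "\<And>i. i \<in> level j \<Longrightarrow> (\<integral>\<^sup>+u. coord_mass {0} (x u - y u) \<partial>K i) \<le> e"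
  shows "(\<integral>\<^sup>+z. ennreal \<bar>level_sum (\<lambda>i. x (z i)) j - level_sum (\<lambda>i. y (z i)) j\<bar> \<partial>Z)
    \<le> q * weight_gap x y j + e * mean_weight y j"
proof -
  let ?px = "\<lambda>z i. path_weight (\<lambda>j. x (z j)) i" and ?py = "\<lambda>z i. path_weight (\<lambda>j. y (z j)) i"
  have "(\<integral>\<^sup>+z. ennreal \<bar>level_sum (\<lambda>i. x (z i)) j - level_sum (\<lambda>i. y (z i)) j\<bar> \<partial>Z)
      \<le> (\<integral>\<^sup>+z. \<integral>\<^sup>+i. ennreal \<bar>x (z i) 0 * ?px z i - y (z i) 0 * ?py z i\<bar> \<partial>count_space (level j) \<partial>Z)"
    unfolding level_sum_def by (intro nn_integral_mono abs_infsum_diff_le)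
  also have "\<dots> = (\<integral>\<^sup>+i. \<integral>\<^sup>+z. ennreal \<bar>x (z i) 0 * ?px z i - y (z i) 0 * ?py z i\<bar> \<partial>Z \<partial>count_space (level j))"
  proof (rule nn_integral_count_space_nn_integral[OF countable_level])
    fix i assume "i \<in> level j"
    then have n: "i \<in> nodes" by (rule level_in_nodes)
    note [measurable] = marking_coordinate[OF x n] marking_coordinate[OF y n]
      marking_path_weight[OF x n] marking_path_weight[OF y n]
    show "(\<lambda>z. ennreal \<bar>x (z i) 0 * ?px z i - y (z i) 0 * ?py z i\<bar>) \<in> borel_measurable Z"
      by measurable
  qed
  also have "\<dots> \<le> q * weight_gap x y j + e * mean_weight y j"
    using level_step[OF x y q e] by (simp add: nn_integral_count_space_finite)
  finally show ?thesis .
qed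

lemma level_sum_le:
  assumes y: "marking y"
    and e: "\<And>i. i \<in> level j \<Longrightarrow> (\<integral>\<^sup>+u. coord_mass {0} (y u) \<partial>K i) \<le> e"
  shows "(\<integral>\<^sup>+z. ennreal \<bar>level_sum (\<lambda>i. y (z i)) j\<bar> \<partial>Z) \<le> e * mean_weight y j"
proof -
  have "level_sum (\<lambda>_ _. 0) j = 0"
    by (simp add: level_sum_def)
  then show ?thesis
    using level_sum_diff_le[OF marking_zero y, of j 0 e] e by (simp add: coord_mass_def)
qed

end

section \<open>Couplings of two-type trees\<close>

lemma sets_couplings:
  assumes "\<pi> \<in> couplings \<mu> \<nu>" "sets \<mu> = sets borel" "sets \<nu> = sets borel"
  shows "sets \<pi> = sets (borel \<Otimes>\<^sub>M borel)"
  using assms by (auto simp: couplings_def cong: sets_pair_measure_cong)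

text \<open>The marginals in \<open>couplings\<close> are image measures with target
  \<open>\<mu>\<close> or \<open>\<nu>\<close>. An image measure depends on its target only through
  the measurable sets, so the target may be \<open>borel\<close>.\<close>

lemma coupling_marginals:
  assumes \<pi>: "\<pi> \<in> couplings \<mu> \<nu>" and \<mu>: "sets \<mu> = sets borel" and \<nu>: "sets \<nu> = sets borel"
  shows "fst \<in> borel_measurable \<pi>" "snd \<in> borel_measurable \<pi>"
    and "distr \<pi> borel fst = \<mu>" "distr \<pi> borel snd = \<nu>"
proof -
  note s = sets_couplings[OF assms]
  show "fst \<in> borel_measurable \<pi>" "snd \<in> borel_measurable \<pi>"
    by (simp_all only: measurable_cong_sets[OF s refl] measurable_fst measurable_snd)
  have "distr \<pi> borel fst = distr \<pi> \<mu> fst" "distr \<pi> borel snd = distr \<pi> \<nu> snd"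
    by (rule distr_cong; simp add: \<mu> \<nu>)+
  then show "distr \<pi> borel fst = \<mu>" "distr \<pi> borel snd = \<nu>"
    using \<pi> by (simp_all add: couplings_def)
qed

lemma prob_space_coupling:
  assumes "\<pi> \<in> couplings \<mu> \<nu>" "sets \<mu> = sets borel" "sets \<nu> = sets borel" "prob_space \<mu>"
  shows "prob_space \<pi>"
proof (rule prob_space_distrD[where f = fst and N = borel])
  show "fst \<in> borel_measurable \<pi>" "prob_space (distr \<pi> borel fst)"
    using coupling_marginals[OF assms(1-3)] assms(4) by simp_all
qed

text \<open>The joint law of \<open>X\<close> and \<open>Y\<close> under \<open>P\<close> is one of
  the couplings over which the infimum runs.\<close>

lemma kr_dist_distr_le:
  assumes X: "X \<in> borel_measurable P" and Y: "Y \<in> borel_measurable P"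
    and nrm: "(\<lambda>p. nrm (fst p - snd p)) \<in> borel_measurable (borel \<Otimes>\<^sub>M borel)"
  shows "kr_dist nrm (distr P borel X) (distr P borel Y) \<le> (\<integral>\<^sup>+z. nrm (X z - Y z) \<partial>P)"
proof -
  let ?\<pi> = "distr P (borel \<Otimes>\<^sub>M borel) (\<lambda>z. (X z, Y z))"
  have XY: "(\<lambda>z. (X z, Y z)) \<in> P \<rightarrow>\<^sub>M borel \<Otimes>\<^sub>M borel"
    using X Y by (rule measurable_Pair)
  have "distr ?\<pi> (distr P borel X) fst = distr ?\<pi> borel fst"
    "distr ?\<pi> (distr P borel Y) snd = distr ?\<pi> borel snd"
    by (rule distr_cong; simp)+
  then have "?\<pi> \<in> couplings (distr P borel X) (distr P borel Y)"
    using XY by (auto simp: couplings_def distr_distr comp_def cong: sets_pair_measure_cong)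
  then have "kr_dist nrm (distr P borel X) (distr P borel Y)
      \<le> (\<integral>\<^sup>+z. nrm (fst z - snd z) \<partial>?\<pi>)"
    unfolding kr_dist_def by (rule INF_lower)
  also have "\<dots> = (\<integral>\<^sup>+z. nrm (X z - Y z) \<partial>P)"
    using XY nrm by (simp add: nn_integral_distr)
  finally show ?thesis .
qed

lemma measurable_l1_real_diff:
  "(\<lambda>p. l1_real (fst p - snd p)) \<in> borel_measurable (borel \<Otimes>\<^sub>M borel)"
  unfolding l1_real_def by measurable

lemma measurable_l1_seq_diff:
  "(\<lambda>p. l1_seq (fst p - snd p)) \<in> borel_measurable (borel \<Otimes>\<^sub>M borel)"
proof -
  have "(\<lambda>p. fst p - snd p :: nat \<Rightarrow> real) \<in> borel_measurable (borel \<Otimes>\<^sub>M borel)"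
    by (rule measurable_seqI) simp
  from measurable_compose[OF this borel_measurable_l1_seq] show ?thesis .
qed

section \<open>Laws of marked trees and pathwise bounds for their sums\<close>

definition tree_law :: "'c measure \<Rightarrow> 'c measure \<Rightarrow> (nat list \<Rightarrow> 'c) measure" where
  "tree_law \<kappa>\<^sub>0 \<kappa> = PiM nodes (\<lambda>i. if i = [] then \<kappa>\<^sub>0 else \<kappa>)"

text \<open>Applied to \<open>fst\<close> and \<open>snd\<close>, this identifies the two marginals
  of a tree whose nodes carry independent coupled pairs.\<close>

lemma distr_tree_law:
  assumes "prob_space \<kappa>\<^sub>0" "prob_space \<kappa>" "f \<in> \<kappa>\<^sub>0 \<rightarrow>\<^sub>M S" "f \<in> \<kappa> \<rightarrow>\<^sub>M S"
  shows "distr (tree_law \<kappa>\<^sub>0 \<kappa>) (PiM nodes (\<lambda>_. S)) (\<lambda>z. \<lambda>i\<in>nodes. f (z i))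
    = tree_law (distr \<kappa>\<^sub>0 S f) (distr \<kappa> S f)"
proof -
  have "distr (tree_law \<kappa>\<^sub>0 \<kappa>) (PiM nodes (\<lambda>_. S)) (\<lambda>z. \<lambda>i\<in>nodes. f (z i))
      = PiM nodes (\<lambda>i. distr (if i = [] then \<kappa>\<^sub>0 else \<kappa>) S f)"
    unfolding tree_law_def by (rule PiM_distr_component) (use assms in auto)
  then show ?thesis
    by (simp add: tree_law_def if_distrib[of "\<lambda>k. distr k S f"])
qed

lemma sets_tree_law:
  assumes "sets \<kappa>\<^sub>0 = sets S" "sets \<kappa> = sets S"
  shows "sets (tree_law \<kappa>\<^sub>0 \<kappa>) = sets (PiM nodes (\<lambda>_. S))"
  unfolding tree_law_def using assms by (intro sets_PiM_cong) auto

lemma prob_space_tree_law: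
  "prob_space \<kappa>\<^sub>0 \<Longrightarrow> prob_space \<kappa> \<Longrightarrow> prob_space (tree_law \<kappa>\<^sub>0 \<kappa>)"
  unfolding tree_law_def by (rule prob_space_PiM) simp

lemma tree_sum_diff_le:
  "ennreal \<bar>tree_sum k x - tree_sum k y\<bar>
    \<le> (\<Sum>j\<le>k. ennreal \<bar>level_sum x j - level_sum y j\<bar>)"
  by (auto simp: tree_sum_def sum_subtractf[symmetric] intro!: ennreal_leI sum_abs)

text \<open>If the tail on the right diverges there is nothing to prove. Otherwise the level sums of
  \<open>y\<close> are summable and \<open>tree_limit y\<close> is \<open>tree_sum k y\<close> plus
  the tail from level \<open>Suc k\<close> on.\<close>

lemma tree_sum_tree_limit_diff_le:
  "ennreal \<bar>tree_sum k x - tree_limit y\<bar>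
    \<le> (\<Sum>j\<le>k. ennreal \<bar>level_sum x j - level_sum y j\<bar>) + (\<Sum>j. ennreal \<bar>level_sum y (j + Suc k)\<bar>)"
proof (cases "(\<Sum>j. ennreal \<bar>level_sum y (j + Suc k)\<bar>) = top")
  case False
  then have s: "summable (\<lambda>j. \<bar>level_sum y (j + Suc k)\<bar>)"
    by (intro summable_suminf_not_top) auto
  then have "summable (\<lambda>j. level_sum y (j + Suc k))"
    by (rule summable_rabs_cancel)
  then have "summable (level_sum y)"
    by (simp only: summable_iff_shift)
  then have "tree_limit y = (\<Sum>j. level_sum y (j + Suc k)) + tree_sum k y"
    using suminf_split_initial_segment[of "level_sum y" "Suc k"]
    by (simp add: tree_limit_def tree_sum_def lessThan_Suc_atMost)
  then have "\<bar>tree_sum k x - tree_limit y\<bar>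
      \<le> \<bar>tree_sum k x - tree_sum k y\<bar> + (\<Sum>j. \<bar>level_sum y (j + Suc k)\<bar>)"
    using summable_rabs[OF s] by linarith
  then have "ennreal \<bar>tree_sum k x - tree_limit y\<bar>
      \<le> ennreal \<bar>tree_sum k x - tree_sum k y\<bar> + ennreal (\<Sum>j. \<bar>level_sum y (j + Suc k)\<bar>)"
    using suminf_nonneg[OF s] by (simp add: ennreal_plus[symmetric] ennreal_leI del: ennreal_plus)
  also have "ennreal (\<Sum>j. \<bar>level_sum y (j + Suc k)\<bar>) = (\<Sum>j. ennreal \<bar>level_sum y (j + Suc k)\<bar>)"
    using s by (simp add: suminf_ennreal2)
  finally show ?thesis
    using tree_sum_diff_le[of k x y] by (meson add_mono order_refl order_trans)
qed simp

lemma tree_limit_le: "ennreal \<bar>tree_limit y\<bar> \<le> (\<Sum>j. ennreal \<bar>level_sum y j\<bar>)"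
proof (cases "(\<Sum>j. ennreal \<bar>level_sum y j\<bar>) = top")
  case False
  then have s: "summable (\<lambda>j. \<bar>level_sum y j\<bar>)"
    by (intro summable_suminf_not_top) auto
  then have "\<bar>tree_limit y\<bar> \<le> (\<Sum>j. \<bar>level_sum y j\<bar>)"
    unfolding tree_limit_def by (rule summable_rabs)
  then show ?thesis
    using s by (simp add: suminf_ennreal2 ennreal_leI)
qed simp

lemma tree_sum_le: "ennreal \<bar>tree_sum k y\<bar> \<le> (\<Sum>j\<le>k. ennreal \<bar>level_sum y j\<bar>)"
  by (auto simp: tree_sum_def intro!: ennreal_leI sum_abs)

section \<open>Explicit bounds obtained from the recursions\<close>

text \<open>The recursion for \<open>b_j\<close> read as an equality and shifted by one: entry
  \<open>j\<close> belongs to level \<open>Suc j\<close>. The step out of the root has cost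
  \<open>e\<^sub>0\<close>, and \<open>m\<^sub>0 * \<rho> ^ j\<close> bounds the mean weight of
  level \<open>Suc j\<close>.\<close>

fun gap_bound :: "ennreal \<Rightarrow> ennreal \<Rightarrow> ennreal \<Rightarrow> ennreal \<Rightarrow> nat \<Rightarrow> ennreal" where
  "gap_bound \<rho> m\<^sub>0 e\<^sub>0 e 0 = e\<^sub>0"
| "gap_bound \<rho> m\<^sub>0 e\<^sub>0 e (Suc j) = (\<rho> + e) * gap_bound \<rho> m\<^sub>0 e\<^sub>0 e j + e * (m\<^sub>0 * \<rho> ^ j)"

text \<open>Bounds the total expected difference over the levels up to \<open>k\<close>:
  \<open>e\<^sub>0\<close> belongs to level 0 and summand \<open>j\<close> to level
  \<open>Suc j\<close>. The constant \<open>m\<close> is the mean l1 norm of a limit mark away from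
  the root.\<close>

definition sum_bound :: "ennreal \<Rightarrow> ennreal \<Rightarrow> ennreal \<Rightarrow> ennreal \<Rightarrow> ennreal \<Rightarrow> nat \<Rightarrow> ennreal" where
  "sum_bound \<rho> m\<^sub>0 m e\<^sub>0 e k =
    e\<^sub>0 + (\<Sum>j<k. (m + e) * gap_bound \<rho> m\<^sub>0 e\<^sub>0 e j + e * (m\<^sub>0 * \<rho> ^ j))"

text \<open>The marking \<open>y\<close> is the reference, later the limit. Its masses
  \<open>root_mass\<close>, \<open>node_mass\<close> and \<open>growth\<close> play the roles of
  \<open>m\<^sub>0\<close>, \<open>m\<close> and \<open>\<rho>\<close> in the bounds above.\<close>

locale two_type_tree =
  fixes \<kappa>\<^sub>0 \<kappa> :: "'c measure" and y :: "'c \<Rightarrow> nat \<Rightarrow> real"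
  assumes prob_\<kappa>\<^sub>0: "prob_space \<kappa>\<^sub>0" and prob_\<kappa>: "prob_space \<kappa>"
    and y0: "y \<in> borel_measurable \<kappa>\<^sub>0" and y: "y \<in> borel_measurable \<kappa>"
begin

sublocale marked_tree "\<lambda>i. if i = [] then \<kappa>\<^sub>0 else \<kappa>"
  by (rule marked_tree.intro) (simp add: prob_\<kappa>\<^sub>0 prob_\<kappa>)

abbreviation T :: "(nat list \<Rightarrow> 'c) measure" where
  "T \<equiv> tree_law \<kappa>\<^sub>0 \<kappa>"

definition root_mass :: ennreal where
  "root_mass = (\<integral>\<^sup>+u. l1_seq (y u) \<partial>\<kappa>\<^sub>0)"

definition node_mass :: ennreal where
  "node_mass = (\<integral>\<^sup>+u. l1_seq (y u) \<partial>\<kappa>)"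

definition growth :: ennreal where
  "growth = (\<integral>\<^sup>+u. coord_mass {1..} (y u) \<partial>\<kappa>)"

lemma marking_y: "marking y"
  using y0 y by (simp add: marking_def)

lemma growth_le: "growth \<le> node_mass"
  unfolding growth_def node_mass_def by (intro nn_integral_mono coord_mass_le_l1_seq)

text \<open>Only the first step leaves the root, and it costs a factor \<open>root_mass\<close>;
  each of the following \<open>j\<close> steps leaves a node with law \<open>\<kappa>\<close> and
  costs a factor \<open>growth\<close>.\<close>

lemma mean_weight_le: "mean_weight y (Suc j) \<le> root_mass * growth ^ j"
proof (induction j)
  case 0
  have "mean_weight y (Suc 0) \<le> root_mass * mean_weight y 0"
    by (rule mean_weight_Suc_le[OF marking_y])
       (auto simp: root_mass_def intro!: nn_integral_mono coord_mass_le_l1_seq)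
  then show ?case by simp
next
  case (Suc j)
  have "mean_weight y (Suc (Suc j)) \<le> growth * mean_weight y (Suc j)"
    by (rule mean_weight_Suc_le[OF marking_y])
       (auto simp: growth_def dest: level_Suc_Nil)
  also have "\<dots> \<le> growth * (root_mass * growth ^ j)"
    using Suc by (rule mult_left_mono) simp
  finally show ?case by (simp add: mult_ac)
qed

lemma level_sum_0_le: "(\<integral>\<^sup>+z. ennreal \<bar>level_sum (\<lambda>i. y (z i)) 0\<bar> \<partial>T) \<le> root_mass"
proof -
  have "(\<integral>\<^sup>+z. ennreal \<bar>level_sum (\<lambda>i. y (z i)) 0\<bar> \<partial>Z) \<le> root_mass * mean_weight y 0"
    by (rule level_sum_le[OF marking_y])
       (auto simp: root_mass_def intro!: nn_integral_mono coord_mass_le_l1_seq)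
  then show ?thesis by (simp add: tree_law_def)
qed

lemma level_sum_Suc_le:
  "(\<integral>\<^sup>+z. ennreal \<bar>level_sum (\<lambda>i. y (z i)) (Suc j)\<bar> \<partial>T) \<le> node_mass * (root_mass * growth ^ j)"
proof -
  have "(\<integral>\<^sup>+z. ennreal \<bar>level_sum (\<lambda>i. y (z i)) (Suc j)\<bar> \<partial>Z) \<le> node_mass * mean_weight y (Suc j)"
    by (rule level_sum_le[OF marking_y])
       (auto simp: node_mass_def dest: level_Suc_Nil intro!: nn_integral_mono coord_mass_le_l1_seq)
  also have "\<dots> \<le> node_mass * (root_mass * growth ^ j)"
    by (intro mult_left_mono mean_weight_le) simp
  finally show ?thesis by (simp add: tree_law_def)
qed

lemma measurable_marks:
  assumes "x \<in> borel_measurable \<kappa>\<^sub>0" "x \<in> borel_measurable \<kappa>"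
  shows "(\<lambda>z. \<lambda>i\<in>nodes. x (z i)) \<in> T \<rightarrow>\<^sub>M PiM nodes (\<lambda>_. borel)"
proof (rule measurable_restrict)
  fix i :: "nat list" assume i: "i \<in> nodes"
  have "x \<in> borel_measurable (if i = [] then \<kappa>\<^sub>0 else \<kappa>)"
    using assms by simp
  then show "(\<lambda>z. x (z i)) \<in> borel_measurable T"
    unfolding tree_law_def
    by (rule measurable_compose[OF measurable_component_singleton[OF i, of "\<lambda>i. if i = [] then \<kappa>\<^sub>0 else \<kappa>"]])
qed

lemma measurable_level_sum_marks:
  assumes "x \<in> borel_measurable \<kappa>\<^sub>0" "x \<in> borel_measurable \<kappa>"
  shows "(\<lambda>z. level_sum (\<lambda>i. x (z i)) j) \<in> borel_measurable T"
  using measurable_compose[OF measurable_marks[OF assms] borel_measurable_level_sum]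
  by (simp only: level_sum_restrict)

lemma nn_integral_tree_sum_le:
  "(\<integral>\<^sup>+z. ennreal \<bar>tree_sum k (\<lambda>i. y (z i))\<bar> \<partial>T)
    \<le> root_mass + (\<Sum>j<k. node_mass * (root_mass * growth ^ j))"
proof -
  note [measurable] = measurable_level_sum_marks[OF y0 y]
  have "(\<integral>\<^sup>+z. ennreal \<bar>tree_sum k (\<lambda>i. y (z i))\<bar> \<partial>T)
      \<le> (\<integral>\<^sup>+z. (\<Sum>j\<le>k. ennreal \<bar>level_sum (\<lambda>i. y (z i)) j\<bar>) \<partial>T)"
    by (intro nn_integral_mono tree_sum_le)
  also have "\<dots> = (\<Sum>j\<le>k. \<integral>\<^sup>+z. ennreal \<bar>level_sum (\<lambda>i. y (z i)) j\<bar> \<partial>T)"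
    by (rule nn_integral_sum) measurable
  finally show ?thesis
    by (elim order_trans, subst sum.atMost_shift)
       (intro add_mono sum_mono level_sum_0_le level_sum_Suc_le)
qed

lemma nn_integral_suminf_level_sum_le:
  "(\<integral>\<^sup>+z. (\<Sum>j. ennreal \<bar>level_sum (\<lambda>i. y (z i)) j\<bar>) \<partial>T)
    \<le> root_mass + (\<Sum>j. node_mass * (root_mass * growth ^ j))"
proof -
  note [measurable] = measurable_level_sum_marks[OF y0 y]
  have "(\<integral>\<^sup>+z. (\<Sum>j. ennreal \<bar>level_sum (\<lambda>i. y (z i)) j\<bar>) \<partial>T)
      = (\<Sum>j. \<integral>\<^sup>+z. ennreal \<bar>level_sum (\<lambda>i. y (z i)) j\<bar> \<partial>T)"
    by (rule nn_integral_suminf) measurable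
  also have "\<dots> = (\<integral>\<^sup>+z. ennreal \<bar>level_sum (\<lambda>i. y (z i)) 0\<bar> \<partial>T)
      + (\<Sum>j. \<integral>\<^sup>+z. ennreal \<bar>level_sum (\<lambda>i. y (z i)) (Suc j)\<bar> \<partial>T)"
    using suminf_offset[OF summableI, of "\<lambda>j. \<integral>\<^sup>+z. ennreal \<bar>level_sum (\<lambda>i. y (z i)) j\<bar> \<partial>T" 1]
    by (simp add: add.commute)
  finally show ?thesis
    by (elim order_trans[OF eq_refl])
       (intro add_mono suminf_le level_sum_0_le level_sum_Suc_le summableI)
qed

section \<open>Comparison of two markings of the same tree\<close>

context
  fixes x :: "'c \<Rightarrow> nat \<Rightarrow> real" and e\<^sub>0 e :: ennreal
  assumes x0: "x \<in> borel_measurable \<kappa>\<^sub>0" and x: "x \<in> borel_measurable \<kappa>"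
    and e\<^sub>0: "(\<integral>\<^sup>+u. l1_seq (x u - y u) \<partial>\<kappa>\<^sub>0) \<le> e\<^sub>0"
    and e: "(\<integral>\<^sup>+u. l1_seq (x u - y u) \<partial>\<kappa>) \<le> e"
begin

lemma marking_x: "marking x"
  using x0 x by (simp add: marking_def)

lemma root_diff_le: "(\<integral>\<^sup>+u. coord_mass S (x u - y u) \<partial>\<kappa>\<^sub>0) \<le> e\<^sub>0"
  by (rule order_trans[OF nn_integral_mono e\<^sub>0]) (rule coord_mass_le_l1_seq)

lemma node_diff_le: "(\<integral>\<^sup>+u. coord_mass S (x u - y u) \<partial>\<kappa>) \<le> e"
  by (rule order_trans[OF nn_integral_mono e]) (rule coord_mass_le_l1_seq)

text \<open>The marking \<open>x\<close> is controlled through \<open>y\<close> by the triangle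
  inequality, so every constant comes from the reference and the cost. With \<open>S = {1..}\<close>
  this produces the factor \<open>growth + e\<close>.\<close>

lemma node_coord_le:
  "(\<integral>\<^sup>+u. coord_mass S (x u) \<partial>\<kappa>) \<le> (\<integral>\<^sup>+u. coord_mass S (y u) \<partial>\<kappa>) + e"
proof -
  note [measurable] = x y
  have d: "(\<lambda>u. x u - y u) \<in> borel_measurable \<kappa>"
    by (rule measurable_seqI) simp
  have dm: "(\<lambda>u. coord_mass S (x u - y u)) \<in> borel_measurable \<kappa>"
    by (rule measurable_compose[OF d borel_measurable_coord_mass])
  have "(\<integral>\<^sup>+u. coord_mass S (x u) \<partial>\<kappa>) \<le> (\<integral>\<^sup>+u. coord_mass S (y u) + coord_mass S (x u - y u) \<partial>\<kappa>)"
    by (intro nn_integral_mono coord_mass_triangle)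
  also have "\<dots> = (\<integral>\<^sup>+u. coord_mass S (y u) \<partial>\<kappa>) + (\<integral>\<^sup>+u. coord_mass S (x u - y u) \<partial>\<kappa>)"
    by (rule nn_integral_add[OF _ dm]) simp
  also have "\<dots> \<le> (\<integral>\<^sup>+u. coord_mass S (y u) \<partial>\<kappa>) + e"
    by (intro add_mono order_refl node_diff_le)
  finally show ?thesis .
qed

lemma weight_gap_le: "weight_gap x y (Suc j) \<le> gap_bound growth root_mass e\<^sub>0 e j"
proof (induction j)
  case 0
  \<comment> \<open>The coefficient \<open>top\<close> is harmless: at the root the gap of path
    weights is 0, and \<open>top * 0 = 0\<close>.\<close>
  have "weight_gap x y (Suc 0) \<le> top * weight_gap x y 0 + e\<^sub>0 * mean_weight y 0"
    by (rule weight_gap_Suc_le[OF marking_x marking_y]) (auto intro: root_diff_le)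
  then show ?case by simp
next
  case (Suc j)
  have "weight_gap x y (Suc (Suc j)) \<le> (growth + e) * weight_gap x y (Suc j) + e * mean_weight y (Suc j)"
    by (rule weight_gap_Suc_le[OF marking_x marking_y])
       (auto dest: level_Suc_Nil simp: growth_def intro: node_diff_le node_coord_le)
  also have "\<dots> \<le> (growth + e) * gap_bound growth root_mass e\<^sub>0 e j + e * (root_mass * growth ^ j)"
    by (intro add_mono mult_left_mono Suc mean_weight_le) simp_all
  finally show ?case by simp
qed

lemma nn_integral_level_sum_diff_le:
  "(\<Sum>j\<le>k. \<integral>\<^sup>+z. ennreal \<bar>level_sum (\<lambda>i. x (z i)) j - level_sum (\<lambda>i. y (z i)) j\<bar> \<partial>T)
    \<le> sum_bound growth root_mass node_mass e\<^sub>0 e k"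
proof -
  have zero: "(\<integral>\<^sup>+z. ennreal \<bar>level_sum (\<lambda>i. x (z i)) 0 - level_sum (\<lambda>i. y (z i)) 0\<bar> \<partial>T) \<le> e\<^sub>0"
  proof -
    \<comment> \<open>Again \<open>top\<close> meets the vanishing gap at the root, so only the cost
      \<open>e\<^sub>0\<close> remains.\<close>
    have "(\<integral>\<^sup>+z. ennreal \<bar>level_sum (\<lambda>i. x (z i)) 0 - level_sum (\<lambda>i. y (z i)) 0\<bar> \<partial>Z)
        \<le> top * weight_gap x y 0 + e\<^sub>0 * mean_weight y 0"
      by (rule level_sum_diff_le[OF marking_x marking_y]) (auto intro: root_diff_le)
    then show ?thesis by (simp add: tree_law_def)
  qed
  have suc: "(\<integral>\<^sup>+z. ennreal \<bar>level_sum (\<lambda>i. x (z i)) (Suc j) - level_sum (\<lambda>i. y (z i)) (Suc j)\<bar> \<partial>T)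
      \<le> (node_mass + e) * gap_bound growth root_mass e\<^sub>0 e j + e * (root_mass * growth ^ j)" for j
  proof -
    have n: "(\<integral>\<^sup>+u. coord_mass {0} (x u) \<partial>\<kappa>) \<le> node_mass + e"
      by (rule order_trans[OF node_coord_le add_right_mono])
         (auto simp: node_mass_def intro!: nn_integral_mono coord_mass_le_l1_seq)
    have "(\<integral>\<^sup>+z. ennreal \<bar>level_sum (\<lambda>i. x (z i)) (Suc j) - level_sum (\<lambda>i. y (z i)) (Suc j)\<bar> \<partial>Z)
        \<le> (node_mass + e) * weight_gap x y (Suc j) + e * mean_weight y (Suc j)"
      by (rule level_sum_diff_le[OF marking_x marking_y])
         (auto dest: level_Suc_Nil intro: node_diff_le n)
    also have "\<dots> \<le> (node_mass + e) * gap_bound growth root_mass e\<^sub>0 e j + e * (root_mass * growth ^ j)"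
      by (intro add_mono mult_left_mono weight_gap_le mean_weight_le) simp_all
    finally show ?thesis by (simp add: tree_law_def)
  qed
  show ?thesis
    unfolding sum_bound_def
    by (subst sum.atMost_shift) (intro add_mono sum_mono zero suc)
qed

lemma nn_integral_tree_sum_diff_le:
  "(\<integral>\<^sup>+z. ennreal \<bar>tree_sum k (\<lambda>i. x (z i)) - tree_sum k (\<lambda>i. y (z i))\<bar> \<partial>T)
    \<le> sum_bound growth root_mass node_mass e\<^sub>0 e k"
proof -
  note [measurable] = measurable_level_sum_marks[OF x0 x] measurable_level_sum_marks[OF y0 y]
  have "(\<integral>\<^sup>+z. ennreal \<bar>tree_sum k (\<lambda>i. x (z i)) - tree_sum k (\<lambda>i. y (z i))\<bar> \<partial>T)
      \<le> (\<integral>\<^sup>+z. (\<Sum>j\<le>k. ennreal \<bar>level_sum (\<lambda>i. x (z i)) j - level_sum (\<lambda>i. y (z i)) j\<bar>) \<partial>T)"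
    by (intro nn_integral_mono tree_sum_diff_le)
  also have "\<dots> = (\<Sum>j\<le>k. \<integral>\<^sup>+z. ennreal \<bar>level_sum (\<lambda>i. x (z i)) j - level_sum (\<lambda>i. y (z i)) j\<bar> \<partial>T)"
    by (rule nn_integral_sum) measurable
  finally show ?thesis
    using nn_integral_level_sum_diff_le by (rule order_trans)
qed

text \<open>The levels up to \<open>k\<close> are compared, and the remaining levels of
  \<open>y\<close> are bounded by their moments. Level \<open>j + Suc k\<close> gives the power
  \<open>j + k\<close>, because the step out of the root contributes \<open>root_mass\<close>
  instead of \<open>growth\<close>.\<close>

lemma nn_integral_tree_sum_tree_limit_diff_le:
  "(\<integral>\<^sup>+z. ennreal \<bar>tree_sum k (\<lambda>i. x (z i)) - tree_limit (\<lambda>i. y (z i))\<bar> \<partial>T)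
    \<le> sum_bound growth root_mass node_mass e\<^sub>0 e k
      + (\<Sum>j. node_mass * (root_mass * growth ^ (j + k)))"
proof -
  note [measurable] = measurable_level_sum_marks[OF x0 x] measurable_level_sum_marks[OF y0 y]
  have "(\<integral>\<^sup>+z. ennreal \<bar>tree_sum k (\<lambda>i. x (z i)) - tree_limit (\<lambda>i. y (z i))\<bar> \<partial>T)
      \<le> (\<integral>\<^sup>+z. (\<Sum>j\<le>k. ennreal \<bar>level_sum (\<lambda>i. x (z i)) j - level_sum (\<lambda>i. y (z i)) j\<bar>)
          + (\<Sum>j. ennreal \<bar>level_sum (\<lambda>i. y (z i)) (j + Suc k)\<bar>) \<partial>T)"
    by (intro nn_integral_mono tree_sum_tree_limit_diff_le)
  also have "\<dots> = (\<Sum>j\<le>k. \<integral>\<^sup>+z. ennreal \<bar>level_sum (\<lambda>i. x (z i)) j - level_sum (\<lambda>i. y (z i)) j\<bar> \<partial>T)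
      + (\<Sum>j. \<integral>\<^sup>+z. ennreal \<bar>level_sum (\<lambda>i. y (z i)) (j + Suc k)\<bar> \<partial>T)"
    by (subst nn_integral_add; (subst nn_integral_sum nn_integral_suminf)?; measurable)
       (simp add: nn_integral_suminf nn_integral_sum)
  also have "\<dots> \<le> sum_bound growth root_mass node_mass e\<^sub>0 e k
      + (\<Sum>j. node_mass * (root_mass * growth ^ (j + k)))"
    using level_sum_Suc_le
    by (intro add_mono nn_integral_level_sum_diff_le suminf_le summableI) simp
  finally show ?thesis .
qed

end

end

section \<open>Convergence of the tree sums\<close>

text \<open>Finiteness comes from the real geometric series. The fixed-point identity is a shift of
  the index; it replaces the closed form, which would need division.\<close>

lemma ennreal_geometric:
  fixes b :: ennreal
  assumes "b < 1"
  shows "(\<Sum>j. b ^ j) < top" "(\<Sum>j. b ^ j) = 1 + b * (\<Sum>j. b ^ j)"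
proof -
  obtain r where r: "0 \<le> r" "r < 1" "b = ennreal r"
    using assms by (cases b) (auto simp: ennreal_less_iff simp flip: ennreal_1)
  have "(\<Sum>j. b ^ j) = (\<Sum>j. ennreal (r ^ j))"
    using r by (simp add: ennreal_power)
  also have "\<dots> = ennreal (\<Sum>j. r ^ j)"
    using r by (intro suminf_ennreal2 summable_geometric) auto
  finally show "(\<Sum>j. b ^ j) < top" by simp
  show "(\<Sum>j. b ^ j) = 1 + b * (\<Sum>j. b ^ j)"
  proof -
    have "(\<Sum>j. b ^ j) = (\<Sum>j. b ^ (j + 1)) + (\<Sum>j<1. b ^ j)"
      by (rule suminf_offset[OF summableI])
    also have "\<dots> = 1 + b * (\<Sum>j. b ^ j)"
      by (simp add: add.commute)
    finally show ?thesis .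
  qed
qed

lemma ennreal_power_tendsto_0:
  fixes b :: ennreal
  assumes "b < 1"
  shows "(\<lambda>k. b ^ k) \<longlonglongrightarrow> 0"
proof -
  obtain r where r: "0 \<le> r" "r < 1" "b = ennreal r"
    using assms by (cases b) (auto simp: ennreal_less_iff simp flip: ennreal_1)
  then have "(\<lambda>k. ennreal (r ^ k)) \<longlonglongrightarrow> ennreal 0"
    by (intro tendsto_ennrealI LIMSEQ_realpow_zero)
  then show ?thesis using r by (simp add: ennreal_power)
qed

text \<open>Finiteness of \<open>l\<close> excludes the limit \<open>top * 0\<close>, at which
  multiplication is discontinuous.\<close>

lemma tendsto_0_mult_ennreal:
  fixes f g :: "'a \<Rightarrow> ennreal"
  assumes "(f \<longlongrightarrow> l) F" "(g \<longlongrightarrow> 0) F" "l < top"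
  shows "((\<lambda>x. f x * g x) \<longlongrightarrow> 0) F"
  using tendsto_mult_ennreal[OF assms(1,2)] assms(3) by auto

lemma tendsto_0_ennreal_le:
  fixes f g :: "nat \<Rightarrow> ennreal"
  assumes "eventually (\<lambda>n. f n \<le> g n) sequentially" "g \<longlonglongrightarrow> 0"
  shows "f \<longlonglongrightarrow> 0"
  by (rule tendsto_sandwich[OF _ assms(1) tendsto_const assms(2)]) simp

section \<open>Behaviour of the bounds as the costs vanish\<close>

text \<open>For fixed \<open>j\<close> the recursion combines the costs finitely often with finite
  coefficients, and each of its terms contains a vanishing factor.\<close>

lemma gap_bound_tendsto:
  assumes "e\<^sub>0 \<longlonglongrightarrow> 0" "e \<longlonglongrightarrow> 0" "\<rho> < top" "m\<^sub>0 < top"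
  shows "(\<lambda>n. gap_bound \<rho> m\<^sub>0 (e\<^sub>0 n) (e n) j) \<longlonglongrightarrow> 0"
proof (induction j)
  case 0
  then show ?case using assms(1) by simp
next
  case (Suc j)
  have "(\<lambda>n. \<rho> + e n) \<longlonglongrightarrow> \<rho> + 0"
    by (intro tendsto_add tendsto_const assms(2))
  then have "(\<lambda>n. (\<rho> + e n) * gap_bound \<rho> m\<^sub>0 (e\<^sub>0 n) (e n) j) \<longlonglongrightarrow> 0"
    by (rule tendsto_0_mult_ennreal) (use Suc assms(3) in auto)
  moreover have "(\<lambda>n. (m\<^sub>0 * \<rho> ^ j) * e n) \<longlonglongrightarrow> 0"
    by (rule tendsto_0_mult_ennreal[OF tendsto_const assms(2)])
       (use assms(3,4) in \<open>simp add: ennreal_mult_less_top power_less_top_ennreal\<close>)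
  ultimately have "(\<lambda>n. (\<rho> + e n) * gap_bound \<rho> m\<^sub>0 (e\<^sub>0 n) (e n) j + (m\<^sub>0 * \<rho> ^ j) * e n) \<longlonglongrightarrow> 0 + 0"
    by (rule tendsto_add)
  then show ?case by (simp add: mult.commute)
qed

lemma sum_bound_tendsto:
  assumes "e\<^sub>0 \<longlonglongrightarrow> 0" "e \<longlonglongrightarrow> 0" "\<rho> < top" "m\<^sub>0 < top" "m < top"
  shows "(\<lambda>n. sum_bound \<rho> m\<^sub>0 m (e\<^sub>0 n) (e n) k) \<longlonglongrightarrow> 0"
proof -
  have "(\<lambda>n. (m + e n) * gap_bound \<rho> m\<^sub>0 (e\<^sub>0 n) (e n) j + e n * (m\<^sub>0 * \<rho> ^ j)) \<longlonglongrightarrow> 0" for j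
  proof -
    have "(\<lambda>n. m + e n) \<longlonglongrightarrow> m + 0"
      by (intro tendsto_add tendsto_const assms(2))
    then have "(\<lambda>n. (m + e n) * gap_bound \<rho> m\<^sub>0 (e\<^sub>0 n) (e n) j) \<longlonglongrightarrow> 0"
      by (rule tendsto_0_mult_ennreal) (use gap_bound_tendsto[OF assms(1-4)] assms(5) in auto)
    moreover have "(\<lambda>n. (m\<^sub>0 * \<rho> ^ j) * e n) \<longlonglongrightarrow> 0"
      by (rule tendsto_0_mult_ennreal[OF tendsto_const assms(2)])
         (use assms(3,4) in \<open>simp add: ennreal_mult_less_top power_less_top_ennreal\<close>)
    ultimately have "(\<lambda>n. (m + e n) * gap_bound \<rho> m\<^sub>0 (e\<^sub>0 n) (e n) j + (m\<^sub>0 * \<rho> ^ j) * e n) \<longlonglongrightarrow> 0 + 0"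
      by (rule tendsto_add)
    then show ?thesis by (simp add: mult.commute)
  qed
  then have "(\<lambda>n. e\<^sub>0 n + (\<Sum>j<k. (m + e n) * gap_bound \<rho> m\<^sub>0 (e\<^sub>0 n) (e n) j + e n * (m\<^sub>0 * \<rho> ^ j)))
      \<longlonglongrightarrow> 0 + (\<Sum>j<k. 0)"
    by (intro tendsto_add tendsto_sum assms(1))
  then show ?thesis by (simp add: sum_bound_def)
qed

text \<open>Once \<open>\<rho> + e\<close> stays below some \<open>\<beta> < 1\<close>, the
  recursion contracts and its sums are bounded by a geometric series, uniformly in the depth
  \<open>k\<close>. This allows \<open>k\<close> to grow with the costs still tending to 0.\<close>

lemma sum_bound_uniform:
  fixes \<beta> :: ennreal
  assumes "\<rho> + e \<le> \<beta>" and "\<beta> < 1"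
  defines "W \<equiv> \<Sum>j. \<beta> ^ j"
  shows "sum_bound \<rho> m\<^sub>0 m e\<^sub>0 e k
    \<le> e\<^sub>0 + (m + e) * ((e\<^sub>0 + e * (m\<^sub>0 * W)) * W) + e * (m\<^sub>0 * W)"
proof -
  \<comment> \<open>\<open>X\<close> bounds the total input of the recursion: the initial value plus
    all source terms.\<close>
  define X where "X = e\<^sub>0 + e * (m\<^sub>0 * W)"
  have "\<rho> \<le> \<beta>"
    by (rule order_trans[OF _ assms(1)]) simp
  then have geo: "(\<Sum>j<k. \<rho> ^ j) \<le> W" for k
  proof -
    have "(\<Sum>j<k. \<rho> ^ j) \<le> (\<Sum>j<k. \<beta> ^ j)"
      using \<open>\<rho> \<le> \<beta>\<close> by (intro sum_mono power_mono) auto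
    also have "\<dots> \<le> W"
      unfolding W_def by (intro sum_le_suminf summableI) auto
    finally show ?thesis .
  qed
  have src: "(\<Sum>j<k. e * (m\<^sub>0 * \<rho> ^ j)) \<le> e * (m\<^sub>0 * W)" for k
    unfolding sum_distrib_left[symmetric] by (intro mult_left_mono geo) auto
  \<comment> \<open>Summing the recursion gives a bound of the form \<open>X + \<beta> * s\<close>
    in terms of the previous partial sum \<open>s\<close>. The value \<open>X * W\<close> is a fixed
    point of this map, so induction closes without any subtraction in
    \<open>ennreal\<close>.\<close>
  have gap: "(\<Sum>j<k. gap_bound \<rho> m\<^sub>0 e\<^sub>0 e j) \<le> X * W" for k
  proof (induction k)
    case (Suc k)
    have "(\<Sum>j<Suc k. gap_bound \<rho> m\<^sub>0 e\<^sub>0 e j)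
        = e\<^sub>0 + ((\<rho> + e) * (\<Sum>j<k. gap_bound \<rho> m\<^sub>0 e\<^sub>0 e j) + (\<Sum>j<k. e * (m\<^sub>0 * \<rho> ^ j)))"
      by (simp add: sum.lessThan_Suc_shift sum.distrib sum_distrib_left del: sum.lessThan_Suc)
    also have "\<dots> \<le> e\<^sub>0 + (\<beta> * (X * W) + e * (m\<^sub>0 * W))"
      by (intro add_mono mult_mono assms(1) Suc src) auto
    also have "\<dots> = X * (1 + \<beta> * W)"
      by (simp add: X_def algebra_simps)
    also have "1 + \<beta> * W = W"
      unfolding W_def by (rule ennreal_geometric(2)[symmetric]) fact
    finally show ?case .
  qed simp
  show ?thesis
    unfolding sum_bound_def sum.distrib sum_distrib_left[symmetric] X_def[symmetric] add.assoc
    by (intro add_mono mult_left_mono gap geo) auto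
qed

lemma nn_integral_marginal:
  assumes "\<pi> \<in> couplings \<mu> \<nu>" "sets \<mu> = sets borel" "sets \<nu> = sets borel"
    and g: "g \<in> borel_measurable borel"
  shows "(\<integral>\<^sup>+z. g (snd z) \<partial>\<pi>) = (\<integral>\<^sup>+u. g u \<partial>\<nu>)"
proof -
  have "g \<in> borel_measurable (distr \<pi> borel snd)"
    using g by simp
  from nn_integral_distr[OF coupling_marginals(2)[OF assms(1-3)] this] show ?thesis
    by (simp add: coupling_marginals(4)[OF assms(1-3)])
qed

section \<open>Distance between two trees with coupled marks\<close>

locale law_pair =
  fixes a\<^sub>0 a b\<^sub>0 b :: "(nat \<Rightarrow> real) measure"
  assumes a\<^sub>0: "finite_first_moment l1_seq a\<^sub>0" and a: "finite_first_moment l1_seq a"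
    and b\<^sub>0: "finite_first_moment l1_seq b\<^sub>0" and b: "finite_first_moment l1_seq b"
begin

lemma sets_laws: "sets a\<^sub>0 = sets borel" "sets a = sets borel" "sets b\<^sub>0 = sets borel" "sets b = sets borel"
  and prob_laws: "prob_space a\<^sub>0" "prob_space a" "prob_space b\<^sub>0" "prob_space b"
  using a\<^sub>0 a b\<^sub>0 b by (auto simp: finite_first_moment_def)

text \<open>Independent draws from \<open>\<pi>\<^sub>0\<close> at the root and from
  \<open>\<pi>\<close> elsewhere form a tree of pairs. Its two projections are the given trees, so
  this is a coupling of the tree sums whose cost is already bounded.\<close>

lemma
  assumes \<pi>\<^sub>0: "\<pi>\<^sub>0 \<in> couplings a\<^sub>0 b\<^sub>0" and \<pi>: "\<pi> \<in> couplings a b"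
    and e\<^sub>0: "(\<integral>\<^sup>+z. l1_seq (fst z - snd z) \<partial>\<pi>\<^sub>0) \<le> e\<^sub>0"
    and e: "(\<integral>\<^sup>+z. l1_seq (fst z - snd z) \<partial>\<pi>) \<le> e"
  defines "D \<equiv> sum_bound (\<integral>\<^sup>+u. coord_mass {1..} u \<partial>b) (\<integral>\<^sup>+u. l1_seq u \<partial>b\<^sub>0) (\<integral>\<^sup>+u. l1_seq u \<partial>b) e\<^sub>0 e"
  shows coupling_tree_sum:
      "kr_dist l1_real (distr (tree_law a\<^sub>0 a) borel (tree_sum k)) (distr (tree_law b\<^sub>0 b) borel (tree_sum k)) \<le> D k"
    and coupling_tree_limit:
      "kr_dist l1_real (distr (tree_law a\<^sub>0 a) borel (tree_sum k)) (distr (tree_law b\<^sub>0 b) borel tree_limit)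
        \<le> D k + (\<Sum>j. (\<integral>\<^sup>+u. l1_seq u \<partial>b) * ((\<integral>\<^sup>+u. l1_seq u \<partial>b\<^sub>0) * (\<integral>\<^sup>+u. coord_mass {1..} u \<partial>b) ^ (j + k)))"
proof -
  note m0 = coupling_marginals[OF \<pi>\<^sub>0 sets_laws(1,3)]
  note m = coupling_marginals[OF \<pi> sets_laws(2,4)]
  \<comment> \<open>Taking \<open>snd\<close> as the reference makes all masses those of the limit
    laws; \<open>fst\<close> is the perturbed marking.\<close>
  interpret two_type_tree \<pi>\<^sub>0 \<pi> snd
    by (intro two_type_tree.intro m0 m prob_space_coupling[OF \<pi>\<^sub>0] prob_space_coupling[OF \<pi>]
          sets_laws prob_laws)
  have mass: "growth = (\<integral>\<^sup>+u. coord_mass {1..} u \<partial>b)" "root_mass = (\<integral>\<^sup>+u. l1_seq u \<partial>b\<^sub>0)"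
    "node_mass = (\<integral>\<^sup>+u. l1_seq u \<partial>b)"
    unfolding growth_def root_mass_def node_mass_def
    by (intro nn_integral_marginal[OF \<pi>\<^sub>0] nn_integral_marginal[OF \<pi>] sets_laws
          borel_measurable_coord_mass borel_measurable_l1_seq)+
  let ?F = "\<lambda>z. \<lambda>i\<in>nodes. fst (z i)" and ?S = "\<lambda>z. \<lambda>i\<in>nodes. snd (z i)"
  have F: "distr T (PiM nodes (\<lambda>_. borel)) ?F = tree_law a\<^sub>0 a"
    using distr_tree_law[OF prob_\<kappa>\<^sub>0 prob_\<kappa> m0(1) m(1)] m0 m by simp
  have S: "distr T (PiM nodes (\<lambda>_. borel)) ?S = tree_law b\<^sub>0 b"
    using distr_tree_law[OF prob_\<kappa>\<^sub>0 prob_\<kappa> m0(2) m(2)] m0 m by simp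
  note mF = measurable_marks[OF m0(1) m(1)] and mS = measurable_marks[OF m0(2) m(2)]
  have 1: "distr (tree_law a\<^sub>0 a) borel (tree_sum k) = distr T borel (\<lambda>z. tree_sum k (\<lambda>i. fst (z i)))"
    using distr_distr[OF borel_measurable_tree_sum[of k] mF] by (simp add: F comp_def tree_sum_restrict)
  have 2: "distr (tree_law b\<^sub>0 b) borel (tree_sum k) = distr T borel (\<lambda>z. tree_sum k (\<lambda>i. snd (z i)))"
    using distr_distr[OF borel_measurable_tree_sum[of k] mS] by (simp add: S comp_def tree_sum_restrict)
  have 3: "distr (tree_law b\<^sub>0 b) borel tree_limit = distr T borel (\<lambda>z. tree_limit (\<lambda>i. snd (z i)))"
    using distr_distr[OF borel_measurable_tree_limit mS] by (simp add: S comp_def tree_limit_restrict)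
  have 4: "(\<lambda>z. tree_sum k (\<lambda>i. fst (z i))) \<in> borel_measurable T"
    using measurable_compose[OF mF borel_measurable_tree_sum[of k]] by (simp only: tree_sum_restrict)
  have 5: "(\<lambda>z. tree_sum k (\<lambda>i. snd (z i))) \<in> borel_measurable T"
    using measurable_compose[OF mS borel_measurable_tree_sum[of k]] by (simp only: tree_sum_restrict)
  have 6: "(\<lambda>z. tree_limit (\<lambda>i. snd (z i))) \<in> borel_measurable T"
    using measurable_compose[OF mS borel_measurable_tree_limit] by (simp only: tree_limit_restrict)
  show "kr_dist l1_real (distr (tree_law a\<^sub>0 a) borel (tree_sum k)) (distr (tree_law b\<^sub>0 b) borel (tree_sum k)) \<le> D k"
    using kr_dist_distr_le[OF 4 5 measurable_l1_real_diff]
      nn_integral_tree_sum_diff_le[OF m0(1) m(1) e\<^sub>0 e, of k]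
    unfolding 1 2 D_def mass l1_real_def by (rule order_trans)
  show "kr_dist l1_real (distr (tree_law a\<^sub>0 a) borel (tree_sum k)) (distr (tree_law b\<^sub>0 b) borel tree_limit)
      \<le> D k + (\<Sum>j. (\<integral>\<^sup>+u. l1_seq u \<partial>b) * ((\<integral>\<^sup>+u. l1_seq u \<partial>b\<^sub>0) * (\<integral>\<^sup>+u. coord_mass {1..} u \<partial>b) ^ (j + k)))"
    using kr_dist_distr_le[OF 4 6 measurable_l1_real_diff]
      nn_integral_tree_sum_tree_limit_diff_le[OF m0(1) m(1) e\<^sub>0 e, of k]
    unfolding 1 3 D_def mass l1_real_def by (rule order_trans)
qed

end

lemma ex_coupling:
  assumes "kr_dist nrm \<mu> \<nu> < e"
  shows "\<exists>\<pi>\<in>couplings \<mu> \<nu>. (\<integral>\<^sup>+z. nrm (fst z - snd z) \<partial>\<pi>) \<le> e"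
  using assms unfolding kr_dist_def INF_less_iff by (auto intro: less_imp_le)

section \<open>Integrability and almost sure convergence for one tree\<close>

locale single_tree =
  fixes b\<^sub>0 b :: "(nat \<Rightarrow> real) measure"
  assumes b\<^sub>0: "finite_first_moment l1_seq b\<^sub>0" and b: "finite_first_moment l1_seq b"
begin

lemma sets_laws: "sets b\<^sub>0 = sets borel" "sets b = sets borel"
  and prob_laws: "prob_space b\<^sub>0" "prob_space b"
  using b\<^sub>0 b by (auto simp: finite_first_moment_def)

sublocale two_type_tree b\<^sub>0 b "\<lambda>u. u"
  by (rule two_type_tree.intro) (simp_all add: prob_laws measurable_cong_sets[OF sets_laws(1) refl]
    measurable_cong_sets[OF sets_laws(2) refl])

lemma root_mass_finite: "root_mass < top" and node_mass_finite: "node_mass < top"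
  using b\<^sub>0 b by (auto simp: finite_first_moment_def root_mass_def node_mass_def)

lemma growth_finite: "growth < top"
  using growth_le node_mass_finite by (rule le_less_trans)

lemma prob_T: "prob_space T"
  by (intro prob_space_tree_law prob_laws)

lemma sets_T: "sets T = sets (PiM nodes (\<lambda>_. borel))"
  by (intro sets_tree_law sets_laws)

lemma measurable_tree_sum: "tree_sum k \<in> borel_measurable T"
  and measurable_tree_limit: "tree_limit \<in> borel_measurable T"
  by (simp_all only: measurable_cong_sets[OF sets_T refl] borel_measurable_tree_sum borel_measurable_tree_limit)

lemma finite_first_moment_tree_sum:
  "finite_first_moment l1_real (distr T borel (tree_sum k))"
proof -
  have "(\<integral>\<^sup>+z. ennreal \<bar>tree_sum k z\<bar> \<partial>T) < top"
    by (rule le_less_trans[OF nn_integral_tree_sum_le[of k]])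
       (simp add: root_mass_finite node_mass_finite growth_finite ennreal_mult_less_top power_less_top_ennreal)
  moreover have "(\<integral>\<^sup>+x. l1_real x \<partial>distr T borel (tree_sum k)) = (\<integral>\<^sup>+z. ennreal \<bar>tree_sum k z\<bar> \<partial>T)"
    using measurable_tree_sum unfolding l1_real_def by (subst nn_integral_distr) auto
  ultimately show ?thesis
    using prob_space.prob_space_distr[OF prob_T measurable_tree_sum]
    by (simp add: finite_first_moment_def)
qed

context
  assumes growth_less: "growth < 1"
begin

lemma nn_integral_levels_finite: "(\<integral>\<^sup>+z. (\<Sum>j. ennreal \<bar>level_sum z j\<bar>) \<partial>T) < top"
  by (rule le_less_trans[OF nn_integral_suminf_level_sum_le])
     (simp add: ennreal_suminf_cmult ennreal_geometric(1)[OF growth_less]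
       root_mass_finite node_mass_finite ennreal_mult_less_top)

text \<open>The series of absolute level sums has finite expectation when \<open>growth < 1\<close>,
  hence is finite almost surely.\<close>

lemma AE_summable_level_sum: "AE z in T. summable (level_sum z)"
proof -
  have "level_sum' \<in> borel_measurable T" if "level_sum' = (\<lambda>z. level_sum z j)" for j level_sum'
    using that by (simp only: measurable_cong_sets[OF sets_T refl] borel_measurable_level_sum)
  then have [measurable]: "(\<lambda>z. level_sum z j) \<in> borel_measurable T" for j
    by blast
  have "AE z in T. (\<Sum>j. ennreal \<bar>level_sum z j\<bar>) \<noteq> \<infinity>"
    using nn_integral_levels_finite by (intro nn_integral_PInf_AE) auto
  then show ?thesis
  proof eventually_elim
    case (elim z)
    then have "summable (\<lambda>j. \<bar>level_sum z j\<bar>)"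
      by (intro summable_suminf_not_top) auto
    then show ?case by (rule summable_rabs_cancel)
  qed
qed

lemma finite_first_moment_tree_limit:
  "finite_first_moment l1_real (distr T borel tree_limit)"
proof -
  have "(\<integral>\<^sup>+z. ennreal \<bar>tree_limit z\<bar> \<partial>T) < top"
    by (rule le_less_trans[OF nn_integral_mono[OF tree_limit_le] nn_integral_levels_finite])
  moreover have "(\<integral>\<^sup>+x. l1_real x \<partial>distr T borel tree_limit) = (\<integral>\<^sup>+z. ennreal \<bar>tree_limit z\<bar> \<partial>T)"
    using measurable_tree_limit unfolding l1_real_def by (subst nn_integral_distr) auto
  ultimately show ?thesis
    using prob_space.prob_space_distr[OF prob_T measurable_tree_limit]
    by (simp add: finite_first_moment_def)
qed

end

end

section \<open>Convergence from convergence of the mark laws\<close>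

locale converging_laws =
  fixes a\<^sub>0 a :: "nat \<Rightarrow> (nat \<Rightarrow> real) measure" and b\<^sub>0 b :: "(nat \<Rightarrow> real) measure"
  assumes conv\<^sub>0: "kr_tendsto l1_seq a\<^sub>0 b\<^sub>0" and conv: "kr_tendsto l1_seq a b"
begin

sublocale single_tree b\<^sub>0 b
  using conv\<^sub>0 conv by unfold_locales (auto simp: kr_tendsto_def)

lemma law_pair: "law_pair (a\<^sub>0 n) (a n) b\<^sub>0 b"
  using conv\<^sub>0 conv by unfold_locales (auto simp: kr_tendsto_def)

lemma single_tree: "single_tree (a\<^sub>0 n) (a n)"
  using conv\<^sub>0 conv by unfold_locales (auto simp: kr_tendsto_def)

text \<open>Near-optimal couplings, since the infimum in \<open>kr_dist\<close> need not be attained.\<close>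

lemma near_optimal_costs:
  obtains e\<^sub>0 e where "e\<^sub>0 \<longlonglongrightarrow> 0" "e \<longlonglongrightarrow> 0"
    and "eventually (\<lambda>n. (\<exists>\<pi>\<^sub>0\<in>couplings (a\<^sub>0 n) b\<^sub>0. (\<integral>\<^sup>+z. l1_seq (fst z - snd z) \<partial>\<pi>\<^sub>0) \<le> e\<^sub>0 n)
      \<and> (\<exists>\<pi>\<in>couplings (a n) b. (\<integral>\<^sup>+z. l1_seq (fst z - snd z) \<partial>\<pi>) \<le> e n)) sequentially"
proof -
  \<comment> \<open>A positive slack tending to 0: a coupling within \<open>d n\<close> of the
    infimum exists as soon as the distance is finite, which holds eventually.\<close>
  define d where "d n = ennreal (inverse (real (Suc n)))" for n
  have d: "d \<longlonglongrightarrow> 0"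
    unfolding d_def using tendsto_ennrealI[OF LIMSEQ_inverse_real_of_nat] by simp
  have *: "(\<lambda>n. kr_dist l1_seq (c n) c' + d n) \<longlonglongrightarrow> 0 \<and>
      eventually (\<lambda>n. \<exists>\<pi>\<in>couplings (c n) c'. (\<integral>\<^sup>+z. l1_seq (fst z - snd z) \<partial>\<pi>) \<le> kr_dist l1_seq (c n) c' + d n)
        sequentially"
    if "kr_tendsto l1_seq c c'" for c c'
  proof -
    from that have l: "(\<lambda>n. kr_dist l1_seq (c n) c') \<longlonglongrightarrow> 0"
      by (simp add: kr_tendsto_def)
    have "eventually (\<lambda>n. kr_dist l1_seq (c n) c' < top) sequentially"
      using l by (rule order_tendstoD) simp
    then have "eventually (\<lambda>n. \<exists>\<pi>\<in>couplings (c n) c'. (\<integral>\<^sup>+z. l1_seq (fst z - snd z) \<partial>\<pi>)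
        \<le> kr_dist l1_seq (c n) c' + d n) sequentially"
    proof eventually_elim
      case (elim n)
      then show ?case
        by (intro ex_coupling) (simp add: d_def ennreal_add_left_cancel_less)
    qed
    with tendsto_add[OF l d] show ?thesis by simp
  qed
  show ?thesis
    using *[OF conv\<^sub>0] *[OF conv]
    by (elim conjE) (rule that, assumption, assumption, rule eventually_conj)
qed

theorem tree_sum_converges:
  "kr_tendsto l1_real (\<lambda>n. distr (tree_law (a\<^sub>0 n) (a n)) borel (tree_sum k)) (distr T borel (tree_sum k))"
proof -
  obtain e\<^sub>0 e where e: "e\<^sub>0 \<longlonglongrightarrow> 0" "e \<longlonglongrightarrow> 0"
    and ev: "eventually (\<lambda>n. (\<exists>\<pi>\<^sub>0\<in>couplings (a\<^sub>0 n) b\<^sub>0. (\<integral>\<^sup>+z. l1_seq (fst z - snd z) \<partial>\<pi>\<^sub>0) \<le> e\<^sub>0 n)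
      \<and> (\<exists>\<pi>\<in>couplings (a n) b. (\<integral>\<^sup>+z. l1_seq (fst z - snd z) \<partial>\<pi>) \<le> e n)) sequentially"
    by (rule near_optimal_costs)
  have "eventually (\<lambda>n. kr_dist l1_real (distr (tree_law (a\<^sub>0 n) (a n)) borel (tree_sum k)) (distr T borel (tree_sum k))
      \<le> sum_bound growth root_mass node_mass (e\<^sub>0 n) (e n) k) sequentially"
    using ev
  proof eventually_elim
    case (elim n)
    then show ?case
      unfolding growth_def root_mass_def node_mass_def
      using law_pair.coupling_tree_sum[OF law_pair] by blast
  qed
  then have "(\<lambda>n. kr_dist l1_real (distr (tree_law (a\<^sub>0 n) (a n)) borel (tree_sum k)) (distr T borel (tree_sum k))) \<longlonglongrightarrow> 0"
    by (rule tendsto_0_ennreal_le)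
       (rule sum_bound_tendsto[OF e growth_finite root_mass_finite node_mass_finite])
  then show ?thesis
    using finite_first_moment_tree_sum single_tree.finite_first_moment_tree_sum[OF single_tree]
    by (simp add: kr_tendsto_def)
qed

text \<open>The error splits into differences on the levels up to \<open>k n\<close>, bounded
  uniformly in the depth, and the tail of the limit, which is a finite multiple of
  \<open>growth ^ k n\<close>.\<close>

theorem tree_limit_converges:
  assumes growth_less: "growth < 1" and k: "filterlim k at_top sequentially"
  shows "kr_tendsto l1_real (\<lambda>n. distr (tree_law (a\<^sub>0 n) (a n)) borel (tree_sum (k n))) (distr T borel tree_limit)"
proof -
  obtain e\<^sub>0 e where e: "e\<^sub>0 \<longlonglongrightarrow> 0" "e \<longlonglongrightarrow> 0"
    and ev: "eventually (\<lambda>n. (\<exists>\<pi>\<^sub>0\<in>couplings (a\<^sub>0 n) b\<^sub>0. (\<integral>\<^sup>+z. l1_seq (fst z - snd z) \<partial>\<pi>\<^sub>0) \<le> e\<^sub>0 n)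
      \<and> (\<exists>\<pi>\<in>couplings (a n) b. (\<integral>\<^sup>+z. l1_seq (fst z - snd z) \<partial>\<pi>) \<le> e n)) sequentially"
    by (rule near_optimal_costs)
  \<comment> \<open>The room between \<open>growth\<close> and 1 absorbs the cost: eventually
    \<open>growth + e n < \<beta>\<close>.\<close>
  obtain \<beta> where \<beta>: "growth < \<beta>" "\<beta> < 1"
    using dense[OF growth_less] by blast
  define W where "W = (\<Sum>j. \<beta> ^ j)"
  have W: "W < top"
    unfolding W_def by (rule ennreal_geometric(1)[OF \<beta>(2)])
  have "(\<lambda>n. growth + e n) \<longlonglongrightarrow> growth + 0"
    by (intro tendsto_add tendsto_const e)
  then have ev2: "eventually (\<lambda>n. growth + e n < \<beta>) sequentially"
    using \<beta>(1) by (intro order_tendstoD(2)[where y = "growth + 0"]) simp_all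
  let ?G = "\<Sum>j. growth ^ j"
  \<comment> \<open>The first three summands come from \<open>sum_bound_uniform\<close>, the last
    one is the tail of the limit.\<close>
  let ?B = "\<lambda>n. e\<^sub>0 n + (node_mass + e n) * ((e\<^sub>0 n + e n * (root_mass * W)) * W) + e n * (root_mass * W)
      + (node_mass * (root_mass * ?G)) * growth ^ k n"
  have "eventually (\<lambda>n. kr_dist l1_real (distr (tree_law (a\<^sub>0 n) (a n)) borel (tree_sum (k n))) (distr T borel tree_limit)
      \<le> ?B n) sequentially"
    using ev ev2
  proof eventually_elim
    case (elim n)
    have "kr_dist l1_real (distr (tree_law (a\<^sub>0 n) (a n)) borel (tree_sum (k n))) (distr T borel tree_limit)
        \<le> sum_bound growth root_mass node_mass (e\<^sub>0 n) (e n) (k n)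
          + (\<Sum>j. node_mass * (root_mass * growth ^ (j + k n)))"
      using elim(1) unfolding growth_def root_mass_def node_mass_def
      using law_pair.coupling_tree_limit[OF law_pair] by blast
    also have "(\<Sum>j. node_mass * (root_mass * growth ^ (j + k n)))
        = (node_mass * (root_mass * ?G)) * growth ^ k n"
      by (simp add: power_add ennreal_suminf_cmult ennreal_suminf_multc mult.assoc)
    also have "sum_bound growth root_mass node_mass (e\<^sub>0 n) (e n) (k n)
        \<le> e\<^sub>0 n + (node_mass + e n) * ((e\<^sub>0 n + e n * (root_mass * W)) * W) + e n * (root_mass * W)"
      unfolding W_def using elim(2) \<beta>(2) by (intro sum_bound_uniform) auto
    finally show ?case by (simp add: add_right_mono)
  qed
  moreover have "?B \<longlonglongrightarrow> 0"
  proof -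
    have rW: "root_mass * W < top"
      using W by (simp add: root_mass_finite ennreal_mult_less_top)
    have s: "(\<lambda>n. e n * (root_mass * W)) \<longlonglongrightarrow> 0"
      using tendsto_0_mult_ennreal[OF tendsto_const e(2) rW] by (simp add: mult.commute)
    have x: "(\<lambda>n. e\<^sub>0 n + e n * (root_mass * W)) \<longlonglongrightarrow> 0"
      using tendsto_add[OF e(1) s] by simp
    from tendsto_0_mult_ennreal[OF tendsto_const x W]
    have xW: "(\<lambda>n. (e\<^sub>0 n + e n * (root_mass * W)) * W) \<longlonglongrightarrow> 0"
      by (simp add: mult.commute)
    have nm: "(\<lambda>n. node_mass + e n) \<longlonglongrightarrow> node_mass + 0"
      by (intro tendsto_add tendsto_const e)
    have g: "(\<lambda>n. (node_mass + e n) * ((e\<^sub>0 n + e n * (root_mass * W)) * W)) \<longlonglongrightarrow> 0"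
      using node_mass_finite by (intro tendsto_0_mult_ennreal[OF nm xW]) simp
    have "(\<lambda>n. growth ^ k n) \<longlonglongrightarrow> 0"
      by (rule filterlim_compose[OF ennreal_power_tendsto_0[OF growth_less] k])
    then have t: "(\<lambda>n. (node_mass * (root_mass * ?G)) * growth ^ k n) \<longlonglongrightarrow> 0"
      by (rule tendsto_0_mult_ennreal[OF tendsto_const])
         (simp add: node_mass_finite root_mass_finite ennreal_geometric(1)[OF growth_less] ennreal_mult_less_top)
    show ?thesis
      using tendsto_add[OF tendsto_add[OF tendsto_add[OF e(1) g] s] t] by simp
  qed
  ultimately have "(\<lambda>n. kr_dist l1_real (distr (tree_law (a\<^sub>0 n) (a n)) borel (tree_sum (k n))) (distr T borel tree_limit)) \<longlonglongrightarrow> 0"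
    by (rule tendsto_0_ennreal_le)
  then show ?thesis
    using finite_first_moment_tree_limit[OF growth_less] single_tree.finite_first_moment_tree_sum[OF single_tree]
    by (simp add: kr_tendsto_def)
qed

end

section \<open>Branching processes and trees as marked trees\<close>

lemma snoc_in_generation [simp]:
  "i @ [r] \<in> generation N (Suc j) \<longleftrightarrow> i \<in> generation N j \<and> 1 \<le> r \<and> enat r \<le> N i"
  by auto

lemma generation_subset_level: "generation N j \<subseteq> level j"
proof (induction j)
  case (Suc j)
  then show ?case by (auto simp: level_def)
qed simp

text \<open>Terms off the tree vanish, so the random generation may be enlarged to the deterministic
  level; unordered sums ignore zero terms whether or not they converge.\<close>

lemma generation_sum_eq_level_sum:
  assumes "\<And>i. i \<in> level j \<Longrightarrow>
    y i 0 * path_weight y i = (if i \<in> generation N j then Q i * weight C i else 0)"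
  shows "generation_sum Q N C j = level_sum y j"
  unfolding generation_sum_def level_sum_def
  using assms generation_subset_level[of N j] by (intro infsum_cong_neutral) auto

text \<open>The interface shared by both cases: pathwise, every generation sum is a level sum of
  marks \<open>Y\<close> whose joint law is a \<open>tree_law\<close>. Laws and almost sure
  statements then transfer from the tree of marks.\<close>

definition tree_representation ::
  "'a measure \<Rightarrow> (nat list \<Rightarrow> 'a \<Rightarrow> real) \<Rightarrow> (nat list \<Rightarrow> 'a \<Rightarrow> enat) \<Rightarrow> (nat list \<Rightarrow> 'a \<Rightarrow> real) \<Rightarrow>
    (nat \<Rightarrow> real) measure \<Rightarrow> (nat \<Rightarrow> real) measure \<Rightarrow> bool" where
  "tree_representation M Q N C a\<^sub>0 a \<longleftrightarrow>
    (\<exists>Y \<in> M \<rightarrow>\<^sub>M PiM nodes (\<lambda>_. borel). distr M (PiM nodes (\<lambda>_. borel)) Y = tree_law a\<^sub>0 a \<and>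
      (\<forall>\<omega>\<in>space M. \<forall>j. generation_sum (\<lambda>i. Q i \<omega>) (\<lambda>i. N i \<omega>) (\<lambda>i. C i \<omega>) j = level_sum (Y \<omega>) j))"

lemma tree_representation_distr:
  assumes "tree_representation M Q N C a\<^sub>0 a"
  shows "distr M borel (R_upto Q N C k) = distr (tree_law a\<^sub>0 a) borel (tree_sum k)"
    and "distr M borel (R_limit Q N C) = distr (tree_law a\<^sub>0 a) borel tree_limit"
proof -
  obtain Y where Y: "Y \<in> M \<rightarrow>\<^sub>M PiM nodes (\<lambda>_. borel)"
    and law: "distr M (PiM nodes (\<lambda>_. borel)) Y = tree_law a\<^sub>0 a"
    and eq: "\<And>\<omega> j. \<omega> \<in> space M \<Longrightarrow>
      generation_sum (\<lambda>i. Q i \<omega>) (\<lambda>i. N i \<omega>) (\<lambda>i. C i \<omega>) j = level_sum (Y \<omega>) j"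
    using assms unfolding tree_representation_def by blast
  have "distr M borel (R_upto Q N C k) = distr M borel (tree_sum k \<circ> Y)"
    by (rule distr_cong) (simp_all add: R_upto_def tree_sum_def eq)
  then show "distr M borel (R_upto Q N C k) = distr (tree_law a\<^sub>0 a) borel (tree_sum k)"
    using distr_distr[OF borel_measurable_tree_sum[of k] Y] by (simp add: law)
  have "distr M borel (R_limit Q N C) = distr M borel (tree_limit \<circ> Y)"
    by (rule distr_cong) (simp_all add: R_limit_def tree_limit_def eq)
  then show "distr M borel (R_limit Q N C) = distr (tree_law a\<^sub>0 a) borel tree_limit"
    using distr_distr[OF borel_measurable_tree_limit Y] by (simp add: law)
qed

lemma tree_representation_AE_tendsto:
  assumes rep: "tree_representation M Q N C a\<^sub>0 a"
    and AE: "AE y in tree_law a\<^sub>0 a. summable (level_sum y)"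
  shows "AE \<omega> in M. (\<lambda>k. R_upto Q N C k \<omega>) \<longlonglongrightarrow> R_limit Q N C \<omega>"
proof -
  obtain Y where Y: "Y \<in> M \<rightarrow>\<^sub>M PiM nodes (\<lambda>_. borel)"
    and law: "distr M (PiM nodes (\<lambda>_. borel)) Y = tree_law a\<^sub>0 a"
    and eq: "\<And>\<omega> j. \<omega> \<in> space M \<Longrightarrow>
      generation_sum (\<lambda>i. Q i \<omega>) (\<lambda>i. N i \<omega>) (\<lambda>i. C i \<omega>) j = level_sum (Y \<omega>) j"
    using rep unfolding tree_representation_def by blast
  have "AE \<omega> in M. summable (level_sum (Y \<omega>))"
    using AE by (intro AE_distrD[OF Y]) (simp only: law)
  then show ?thesis
    using AE_space
  proof eventually_elim
    case (elim \<omega>)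
    then show ?case
      using summable_LIMSEQ'[of "level_sum (Y \<omega>)"] by (simp add: R_upto_def R_limit_def eq)
  qed
qed

text \<open>Functions of independent vectors are independent, so the marks have a product law. The
  function \<open>f\<close> may depend on the node, which leaves room for a special mark at the
  root.\<close>

lemma tree_representationI:
  assumes M: "prob_space M" and indep: "prob_space.indep_vars M (\<lambda>_. S) V nodes"
    and f: "\<And>i. i \<in> nodes \<Longrightarrow> f i \<in> borel_measurable S"
    and law: "\<And>i. i \<in> nodes \<Longrightarrow> distr (distr M S (V i)) borel (f i) = (if i = [] then a\<^sub>0 else a)"
    and eq: "\<And>\<omega> i j. \<omega> \<in> space M \<Longrightarrow> i \<in> level j \<Longrightarrow>
      f i (V i \<omega>) 0 * path_weight (\<lambda>i. f i (V i \<omega>)) i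
        = (if i \<in> generation (\<lambda>i. N i \<omega>) j then Q i \<omega> * weight (\<lambda>i. C i \<omega>) i else 0)"
  shows "tree_representation M Q N C a\<^sub>0 a"
proof -
  interpret prob_space M by (rule M)
  have V: "V i \<in> M \<rightarrow>\<^sub>M S" if "i \<in> nodes" for i
    using indep that by (simp add: indep_vars_def)
  have m: "(\<lambda>\<omega>. f i (V i \<omega>)) \<in> borel_measurable M" if "i \<in> nodes" for i
    by (rule measurable_compose[OF V f]) (rule that)+
  have "indep_vars (\<lambda>_. borel) (\<lambda>i \<omega>. f i (V i \<omega>)) nodes"
    using indep f by (rule indep_vars_compose2)
  moreover have "nodes \<noteq> {}"
    using nodes_Nil by blast
  ultimately have "distr M (PiM nodes (\<lambda>_. borel)) (\<lambda>\<omega>. \<lambda>i\<in>nodes. f i (V i \<omega>))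
      = PiM nodes (\<lambda>i. distr M borel (\<lambda>\<omega>. f i (V i \<omega>)))"
    using indep_vars_iff_distr_eq_PiM'[of nodes "\<lambda>i \<omega>. f i (V i \<omega>)" "\<lambda>_. borel"] m by blast
  also have "\<dots> = tree_law a\<^sub>0 a"
    unfolding tree_law_def
    using law distr_distr[OF f V] by (intro PiM_cong) (simp_all add: comp_def)
  finally have "distr M (PiM nodes (\<lambda>_. borel)) (\<lambda>\<omega>. \<lambda>i\<in>nodes. f i (V i \<omega>)) = tree_law a\<^sub>0 a" .
  moreover have "(\<lambda>\<omega>. \<lambda>i\<in>nodes. f i (V i \<omega>)) \<in> M \<rightarrow>\<^sub>M PiM nodes (\<lambda>_. borel)"
    by (intro measurable_restrict m)
  moreover have "generation_sum (\<lambda>i. Q i \<omega>) (\<lambda>i. N i \<omega>) (\<lambda>i. C i \<omega>) j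
      = level_sum (\<lambda>i\<in>nodes. f i (V i \<omega>)) j" if "\<omega> \<in> space M" for \<omega> j
    unfolding level_sum_restrict using eq[OF that] by (rule generation_sum_eq_level_sum)
  ultimately show ?thesis
    unfolding tree_representation_def by blast
qed

section \<open>Marks of a weighted branching process\<close>

text \<open>The map that sends \<open>D\<close> to \<open>wbp_mu D\<close>. Setting the weights
  beyond the offspring number to 0 encodes the shape of the tree in the marks.\<close>

definition wbp_mark :: "real \<times> enat \<times> (nat \<Rightarrow> real) \<Rightarrow> nat \<Rightarrow> real" where
  "wbp_mark = (\<lambda>(q, m, c) r. if r = 0 then q else if enat r \<le> m then c r else 0)"

lemma borel_measurable_wbp_mark: "wbp_mark \<in> borel_measurable wbp_space"
proof (rule measurable_seqI)
  fix r
  show "(\<lambda>v. wbp_mark v r) \<in> borel_measurable wbp_space"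
  proof (cases "r = 0")
    case True
    then show ?thesis
      by (simp add: wbp_mark_def case_prod_beta' wbp_space_def)
  next
    case False
    then have "(\<lambda>c. c r) \<in> borel_measurable (PiM {1..} (\<lambda>_. borel :: real measure))"
      by (intro measurable_component_singleton) auto
    then have [measurable]: "(\<lambda>v. snd (snd v) r) \<in> borel_measurable wbp_space"
      unfolding wbp_space_def
      by (rule measurable_compose[OF measurable_compose[OF measurable_snd measurable_snd]])
    have [measurable]: "(\<lambda>v. fst (snd v)) \<in> wbp_space \<rightarrow>\<^sub>M count_space UNIV"
      unfolding wbp_space_def by measurable
    have "(\<lambda>v. if enat r \<le> fst (snd v) then snd (snd v) r else 0) \<in> borel_measurable wbp_space"
      by measurable
    then show ?thesis
      using False by (simp add: wbp_mark_def case_prod_beta')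
  qed
qed

lemma wbp_tree_representation:
  assumes "weighted_branching_process M D Q N C"
  shows "tree_representation M Q N C (wbp_mu D) (wbp_mu D)"
proof (rule tree_representationI[where f = "\<lambda>_. wbp_mark"])
  show "prob_space M" "prob_space.indep_vars M (\<lambda>_. wbp_space) (wbp_vector Q N C) nodes"
    using assms by (auto simp: weighted_branching_process_def)
  show "wbp_mark \<in> borel_measurable wbp_space"
    by (rule borel_measurable_wbp_mark)
  show "distr (distr M wbp_space (wbp_vector Q N C i)) borel wbp_mark = (if i = [] then wbp_mu D else wbp_mu D)"
    if "i \<in> nodes" for i
    using assms that by (simp add: weighted_branching_process_def wbp_mu_def wbp_mark_def)
  fix \<omega> i j
  let ?y = "\<lambda>i. wbp_mark (wbp_vector Q N C i \<omega>)"
  \<comment> \<open>Induction on the last label: a label above the offspring number of its parent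
    contributes 0, any other contributes the weight of the child, which is stored in the vector of
    the parent.\<close>
  have "path_weight ?y i
      = (if i \<in> generation (\<lambda>i. N i \<omega>) (length i) then weight (\<lambda>i. C i \<omega>) i else 0)" if "i \<in> nodes" for i
    using that
  proof (induction i rule: rev_induct)
    case (snoc r i)
    then show ?case
      by (auto simp: wbp_mark_def wbp_vector_def)
  qed simp
  then show "?y i 0 * path_weight ?y i
      = (if i \<in> generation (\<lambda>i. N i \<omega>) j then Q i \<omega> * weight (\<lambda>i. C i \<omega>) i else 0)" if "i \<in> level j"
    using that by (auto simp: level_def wbp_mark_def wbp_vector_def)
qed

section \<open>Marks of a weighted branching tree\<close>

definition wbt_mark :: "real \<times> nat \<times> real \<Rightarrow> nat \<Rightarrow> real" where
  "wbt_mark = (\<lambda>(q, m, c) r. if r = 0 then c * q else if r \<le> m then c else 0)"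

text \<open>The argument is a point of the space of \<open>wbt_nu\<close>, with the offspring number
  as a real number. Labels up to it get weight 1, the value that replaces the weight of the
  root.\<close>

definition root_mark :: "real \<times> real \<Rightarrow> nat \<Rightarrow> real" where
  "root_mark = (\<lambda>(q, t) r. if r = 0 then q else if real r \<le> t then 1 else 0)"

lemma borel_measurable_wbt_mark: "wbt_mark \<in> borel_measurable wbt_space"
  by (rule measurable_seqI) (simp add: wbt_mark_def wbt_space_def case_prod_beta')

lemma borel_measurable_root_mark [measurable]: "root_mark \<in> borel_measurable borel"
  by (rule measurable_seqI) (simp add: root_mark_def case_prod_beta' borel_prod[symmetric])

lemma measurable_wbt_nu: "(\<lambda>(q, m, c). (q, real m)) \<in> borel_measurable wbt_space"
  by (simp add: wbt_space_def case_prod_beta' borel_prod[symmetric])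

text \<open>
  The weight \<open>C_i\<close> multiplies everything at and below \<open>i\<close>, so it can be moved into the mark of \<open>i\<close>;
  only the root, whose own weight is not used, gets a different mark.
\<close>

lemma wbt_tree_representation:
  assumes "weighted_branching_tree M E Q N C"
  shows "tree_representation M Q N C (distr (wbt_nu E) borel root_mark) (wbt_mu E)"
proof (rule tree_representationI)
  let ?f = "\<lambda>i v. if i = [] then root_mark (case v of (q, m, c) \<Rightarrow> (q, real m)) else wbt_mark v"
  let ?V = "wbt_vector Q N C"
  show "prob_space M" "prob_space.indep_vars M (\<lambda>_. wbt_space) ?V nodes"
    using assms by (auto simp: weighted_branching_tree_def)
  have root: "(\<lambda>v. root_mark (case v of (q, m, c) \<Rightarrow> (q, real m))) \<in> borel_measurable wbt_space"
    by (rule measurable_compose[OF measurable_wbt_nu borel_measurable_root_mark])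
  then show "?f i \<in> borel_measurable wbt_space" for i
    using borel_measurable_wbt_mark by simp
  show "distr (distr M wbt_space (?V i)) borel (?f i)
      = (if i = [] then distr (wbt_nu E) borel root_mark else wbt_mu E)" if i: "i \<in> nodes" for i
  proof -
    have V: "distr M wbt_space (?V i) = E"
      using assms i by (simp add: weighted_branching_tree_def)
    then have E: "sets E = sets wbt_space"
      by (metis sets_distr)
    have "(\<lambda>(q, m, c). (q, real m)) \<in> borel_measurable E"
      using measurable_wbt_nu by (simp only: measurable_cong_sets[OF E refl])
    then show ?thesis
      unfolding V by (auto simp: wbt_nu_def wbt_mu_def wbt_mark_def distr_distr comp_def)
  qed
  fix \<omega> i j assume \<omega>: "\<omega> \<in> space M"
  define y where "y = (\<lambda>i. ?f i (?V i \<omega>))"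
  define c where "c i = (if i = [] then 1 else C i \<omega>)" for i
  let ?G = "generation (\<lambda>i. N i \<omega>)" and ?w = "weight (\<lambda>i. C i \<omega>)"
  \<comment> \<open>Finiteness of the offspring numbers ensures that \<open>the_enat\<close> loses
    nothing.\<close>
  have N: "enat r \<le> N i \<omega> \<longleftrightarrow> r \<le> the_enat (N i \<omega>)" if "i \<in> nodes" for i r
  proof -
    have "N i \<omega> \<noteq> \<infinity>"
      using assms that \<omega> by (simp add: weighted_branching_tree_def)
    then show ?thesis by auto
  qed
  have y: "y i r = (if r = 0 then c i * Q i \<omega> else if enat r \<le> N i \<omega> then c i else 0)"
    if "i \<in> nodes" for i r
    using N[OF that] by (simp add: y_def c_def wbt_vector_def root_mark_def wbt_mark_def)
  \<comment> \<open>On the tree, \<open>path_weight y i\<close> collects \<open>c\<close> over the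
    strict ancestors, while \<open>weight\<close> also contains the weight of \<open>i\<close>. The
    missing factor is \<open>c i\<close>, and it is supplied by coordinate 0 of the mark.\<close>
  have pw: "c i * path_weight y i = (if i \<in> ?G (length i) then ?w i else 0)" if "i \<in> nodes" for i
    using that
  proof (induction i rule: rev_induct)
    case Nil
    show ?case by (simp add: c_def)
  next
    case (snoc r i)
    from snoc.prems have i: "i \<in> nodes" and r: "1 \<le> r" by auto
    have "c (i @ [r]) * path_weight y (i @ [r])
        = C (i @ [r]) \<omega> * (if enat r \<le> N i \<omega> then c i * path_weight y i else 0)"
      using r by (simp add: y[OF i] c_def[of "i @ [r]"])
    also have "\<dots> = (if i @ [r] \<in> ?G (length (i @ [r])) then ?w (i @ [r]) else 0)"
      using r by (simp add: snoc.IH[OF i])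
    finally show ?case .
  qed
  have "y i 0 * path_weight y i = (if i \<in> ?G j then Q i \<omega> * ?w i else 0)" if "i \<in> level j"
  proof -
    have i: "i \<in> nodes" "length i = j"
      using that by (simp_all add: level_def)
    have "y i 0 * path_weight y i = Q i \<omega> * (c i * path_weight y i)"
      by (simp add: y[OF i(1)])
    then show ?thesis
      unfolding pw[OF i(1)] i(2) by simp
  qed
  then show "?f i (?V i \<omega>) 0 * path_weight (\<lambda>i. ?f i (?V i \<omega>)) i
      = (if i \<in> ?G j then Q i \<omega> * ?w i else 0)" if "i \<in> level j"
    using that unfolding y_def by blast
qed

section \<open>Identification of \<open>\<rho>\<close> with the growth rate of the limit
  tree\<close>

lemma coord_mass_tail: "coord_mass {1..} x = (\<Sum>r. ennreal \<bar>x (Suc r)\<bar>)"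
proof -
  have "bij_betw Suc UNIV {1..}"
    by (rule bij_betw_byWitness[where f' = "\<lambda>r. r - 1"]) auto
  then show ?thesis
    unfolding coord_mass_def
    by (subst nn_integral_bij_count_space[symmetric, of Suc UNIV])
       (simp_all add: nn_integral_count_space_nat)
qed

lemma wbp_rho_eq:
  assumes "sets D = sets wbp_space"
  shows "wbp_rho D = (\<integral>\<^sup>+u. coord_mass {1..} u \<partial>wbp_mu D)"
proof -
  have m: "wbp_mark \<in> borel_measurable D"
    using borel_measurable_wbp_mark by (simp only: measurable_cong_sets[OF assms refl])
  have "(\<integral>\<^sup>+u. coord_mass {1..} u \<partial>wbp_mu D) = (\<integral>\<^sup>+v. coord_mass {1..} (wbp_mark v) \<partial>D)"
    unfolding wbp_mu_def wbp_mark_def[symmetric] using m by (simp add: nn_integral_distr)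
  also have "\<dots> = wbp_rho D"
    unfolding wbp_rho_def coord_mass_tail
    by (intro nn_integral_cong) (auto simp: wbp_mark_def intro!: suminf_cong)
  finally show ?thesis ..
qed

text \<open>A mark carries \<open>c\<close> at exactly the labels from 1 to \<open>m\<close>, so its
  mass on \<open>{1..}\<close> is \<open>m\<close> times the absolute value of
  \<open>c\<close>.\<close>

lemma wbt_rho_eq:
  assumes "sets E = sets wbt_space"
  shows "wbt_rho E = (\<integral>\<^sup>+u. coord_mass {1..} u \<partial>wbt_mu E)"
proof -
  have m: "wbt_mark \<in> borel_measurable E"
    using borel_measurable_wbt_mark by (simp only: measurable_cong_sets[OF assms refl])
  have "(\<integral>\<^sup>+u. coord_mass {1..} u \<partial>wbt_mu E) = (\<integral>\<^sup>+v. coord_mass {1..} (wbt_mark v) \<partial>E)"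
    unfolding wbt_mu_def wbt_mark_def[symmetric] using m by (simp add: nn_integral_distr)
  also have "\<dots> = wbt_rho E"
    unfolding wbt_rho_def
  proof (intro nn_integral_cong, clarify)
    fix q m c
    have "coord_mass {1..} (wbt_mark (q, m, c)) = (\<Sum>r. if r < m then ennreal \<bar>c\<bar> else 0)"
      unfolding coord_mass_tail by (auto simp: wbt_mark_def Suc_le_eq intro!: suminf_cong)
    also have "\<dots> = (\<Sum>r<m. ennreal \<bar>c\<bar>)"
      by (subst suminf_finite[of "{..<m}"]) auto
    also have "\<dots> = ennreal (real m * \<bar>c\<bar>)"
      by (simp add: ennreal_mult ennreal_of_nat_eq_real_of_nat)
    finally show "coord_mass {1..} (wbt_mark (q, m, c)) = ennreal (real m * \<bar>c\<bar>)" .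
  qed
  finally show ?thesis ..
qed

section \<open>Convergence of the root marks\<close>

text \<open>The strings of ones of lengths \<open>m\<close> and \<open>n\<close> differ in exactly
  as many places as the distance of \<open>m\<close> and \<open>n\<close>. Thus
  \<open>root_mark\<close> is an isometry on pairs with integer second component.\<close>

lemma l1_seq_root_mark_diff:
  assumes "snd u \<in> \<nat>" "snd v \<in> \<nat>"
  shows "l1_seq (root_mark u - root_mark v) = l1_pair (u - v)"
proof -
  obtain m n where m: "snd u = real m" and n: "snd v = real n"
    using assms by (auto elim!: Nats_cases)
  let ?J = "{min m n<..max m n}"
  have "l1_seq (root_mark u - root_mark v)
      = (\<Sum>r\<in>insert 0 ?J. ennreal \<bar>(root_mark u - root_mark v) r\<bar>)"
    unfolding l1_seq_def
    by (intro suminf_finite) (auto simp: root_mark_def case_prod_beta m n)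
  also have "\<dots> = ennreal \<bar>fst u - fst v\<bar> + (\<Sum>r\<in>?J. ennreal \<bar>(root_mark u - root_mark v) r\<bar>)"
    by (simp add: root_mark_def case_prod_beta)
  also have "(\<Sum>r\<in>?J. ennreal \<bar>(root_mark u - root_mark v) r\<bar>) = (\<Sum>r\<in>?J. 1)"
    by (intro sum.cong) (auto simp: root_mark_def case_prod_beta m n)
  also have "(\<Sum>r\<in>?J. 1) = ennreal \<bar>snd u - snd v\<bar>"
    by (auto simp: m n ennreal_of_nat_eq_real_of_nat max_def min_def of_nat_diff)
  finally show ?thesis
    by (simp only: l1_pair_def fst_diff snd_diff ennreal_plus abs_ge_zero)
qed

text \<open>\<open>wbt_nu\<close> lives on pairs of reals; this puts its mass where the isometry
  applies, and passes to every coupling through the marginals.\<close>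

lemma AE_wbt_nu:
  assumes "sets E = sets wbt_space"
  shows "AE u in wbt_nu E. snd u \<in> \<nat>"
proof -
  have m: "(\<lambda>(q, m, c). (q, real m)) \<in> borel_measurable E"
    using measurable_wbt_nu by (simp only: measurable_cong_sets[OF assms refl])
  have "countable (\<nat> :: real set)"
    by (simp add: Nats_def)
  then have nats: "(\<nat> :: real set) \<in> sets borel"
    by (rule sets.countable[rotated]) simp
  have "(snd :: real \<times> real \<Rightarrow> real) \<in> borel_measurable borel"
    unfolding borel_prod[symmetric] by (rule measurable_snd)
  from measurable_sets[OF this nats]
  have "{u \<in> space borel. snd u \<in> \<nat>} \<in> sets (borel :: (real \<times> real) measure)"
    by (simp add: vimage_def)
  then show ?thesis
    unfolding wbt_nu_def by (subst AE_distr_iff[OF m]) auto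
qed

text \<open>Applying \<open>root_mark\<close> to both components of a coupling of the laws of
  \<open>(Q, N)\<close> gives a coupling of the root laws with the same cost, so the distance does
  not increase.\<close>

lemma kr_tendsto_root:
  assumes E: "\<And>n. sets (E n) = sets wbt_space" and E': "sets E' = sets wbt_space"
    and conv: "kr_tendsto l1_pair (\<lambda>n. wbt_nu (E n)) (wbt_nu E')"
  shows "kr_tendsto l1_seq (\<lambda>n. distr (wbt_nu (E n)) borel root_mark) (distr (wbt_nu E') borel root_mark)"
proof -
  have sets: "sets (wbt_nu F) = sets borel" for F
    by (simp add: wbt_nu_def)
  have meas: "root_mark \<in> borel_measurable (wbt_nu F)" for F
    by (simp add: wbt_nu_def)
  have moment: "finite_first_moment l1_seq (distr (wbt_nu F) borel root_mark)"
    if F: "sets F = sets wbt_space" and fin: "finite_first_moment l1_pair (wbt_nu F)" for F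
  proof -
    \<comment> \<open>The pair \<open>(0, 0)\<close> has the zero sequence as its mark, so the
      isometry also yields equality of the first moments.\<close>
    have zero: "root_mark u - root_mark (0, 0) = root_mark u" for u
      by (auto simp: root_mark_def)
    have "(\<integral>\<^sup>+x. l1_seq x \<partial>distr (wbt_nu F) borel root_mark) = (\<integral>\<^sup>+u. l1_seq (root_mark u) \<partial>wbt_nu F)"
      using meas by (simp add: nn_integral_distr)
    also have "\<dots> = (\<integral>\<^sup>+u. l1_pair u \<partial>wbt_nu F)"
      using AE_wbt_nu[OF F] l1_seq_root_mark_diff[of _ "(0, 0)"]
      by (intro nn_integral_cong_AE) (auto simp: zero l1_pair_def)
    finally show ?thesis
      using fin prob_space.prob_space_distr[OF _ meas] by (simp add: finite_first_moment_def)
  qed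
  have dist: "kr_dist l1_seq (distr (wbt_nu F) borel root_mark) (distr (wbt_nu E') borel root_mark)
      \<le> kr_dist l1_pair (wbt_nu F) (wbt_nu E')" if F: "sets F = sets wbt_space" for F
    unfolding kr_dist_def[of l1_pair]
  proof (rule INF_greatest)
    fix \<pi> assume \<pi>: "\<pi> \<in> couplings (wbt_nu F) (wbt_nu E')"
    note m = coupling_marginals[OF \<pi> sets sets]
    have X: "(\<lambda>z. root_mark (fst z)) \<in> borel_measurable \<pi>" and Y: "(\<lambda>z. root_mark (snd z)) \<in> borel_measurable \<pi>"
      by (rule measurable_compose[OF m(1) borel_measurable_root_mark],
          rule measurable_compose[OF m(2) borel_measurable_root_mark])
    have push: "distr (wbt_nu F) borel root_mark = distr \<pi> borel (\<lambda>z. root_mark (fst z))"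
      "distr (wbt_nu E') borel root_mark = distr \<pi> borel (\<lambda>z. root_mark (snd z))"
      using distr_distr[OF borel_measurable_root_mark m(1)] distr_distr[OF borel_measurable_root_mark m(2)]
      by (simp_all add: m comp_def)
    have "kr_dist l1_seq (distr (wbt_nu F) borel root_mark) (distr (wbt_nu E') borel root_mark)
        \<le> (\<integral>\<^sup>+z. l1_seq (root_mark (fst z) - root_mark (snd z)) \<partial>\<pi>)"
      unfolding push by (rule kr_dist_distr_le[OF X Y measurable_l1_seq_diff])
    also have "\<dots> = (\<integral>\<^sup>+z. l1_pair (fst z - snd z) \<partial>\<pi>)"
    proof (rule nn_integral_cong_AE)
      have "AE z in \<pi>. snd (fst z) \<in> \<nat>" "AE z in \<pi>. snd (snd z) \<in> \<nat>"
        by (rule AE_distrD[OF m(1)], simp only: m AE_wbt_nu[OF F],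
            rule AE_distrD[OF m(2)], simp only: m AE_wbt_nu[OF E'])
      then show "AE z in \<pi>. l1_seq (root_mark (fst z) - root_mark (snd z)) = l1_pair (fst z - snd z)"
        by eventually_elim (rule l1_seq_root_mark_diff)
    qed
    finally show "kr_dist l1_seq (distr (wbt_nu F) borel root_mark) (distr (wbt_nu E') borel root_mark)
        \<le> (\<integral>\<^sup>+z. l1_pair (fst z - snd z) \<partial>\<pi>)" .
  qed
  have "(\<lambda>n. kr_dist l1_seq (distr (wbt_nu (E n)) borel root_mark) (distr (wbt_nu E') borel root_mark)) \<longlonglongrightarrow> 0"
    by (rule tendsto_0_ennreal_le[where g = "\<lambda>n. kr_dist l1_pair (wbt_nu (E n)) (wbt_nu E')"])
       (use conv dist[OF E] in \<open>auto simp: kr_tendsto_def\<close>)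
  then show ?thesis
    using conv moment[OF E] moment[OF E'] by (simp add: kr_tendsto_def)
qed

section \<open>Transfer to the processes and conclusion in the two cases\<close>

lemma tree_representation_converges:
  assumes rep: "\<And>n. tree_representation (M n) (Q n) (N n) (C n) (a\<^sub>0 n) (a n)"
    and rep': "tree_representation M' Q' N' C' b\<^sub>0 b"
    and conv\<^sub>0: "kr_tendsto l1_seq a\<^sub>0 b\<^sub>0" and conv: "kr_tendsto l1_seq a b"
    and \<rho>: "\<rho> = (\<integral>\<^sup>+u. coord_mass {1..} u \<partial>b)"
  shows
    "(\<forall>k. kr_tendsto l1_real
            (\<lambda>n. distr (M n) borel (R_upto (Q n) (N n) (C n) k))
            (distr M' borel (R_upto Q' N' C' k)))
     \<and>
     (\<rho> < 1 \<longrightarrow>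
        (AE \<omega> in M'. (\<lambda>k. R_upto Q' N' C' k \<omega>) \<longlonglongrightarrow> R_limit Q' N' C' \<omega>) \<and>
        (\<forall>k :: nat \<Rightarrow> nat. filterlim k at_top sequentially \<longrightarrow>
           kr_tendsto l1_real
             (\<lambda>n. distr (M n) borel (R_upto (Q n) (N n) (C n) (k n)))
             (distr M' borel (R_limit Q' N' C'))))"
proof -
  interpret converging_laws a\<^sub>0 a b\<^sub>0 b
    by (rule converging_laws.intro[OF conv\<^sub>0 conv])
  have "growth = \<rho>"
    by (simp add: growth_def \<rho>)
  then show ?thesis
    unfolding tree_representation_distr[OF rep] tree_representation_distr[OF rep']
    using tree_sum_converges tree_limit_converges
      tree_representation_AE_tendsto[OF rep' AE_summable_level_sum] by simp
qed

theorem theorem4p4: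
  fixes M :: "nat \<Rightarrow> 'a measure"
    and Q :: "nat \<Rightarrow> nat list \<Rightarrow> 'a \<Rightarrow> real"
    and N :: "nat \<Rightarrow> nat list \<Rightarrow> 'a \<Rightarrow> enat"
    and C :: "nat \<Rightarrow> nat list \<Rightarrow> 'a \<Rightarrow> real"
    and M' :: "'b measure"
    and Q' :: "nat list \<Rightarrow> 'b \<Rightarrow> real"
    and N' :: "nat list \<Rightarrow> 'b \<Rightarrow> enat"
    and C' :: "nat list \<Rightarrow> 'b \<Rightarrow> real"
    and D :: "nat \<Rightarrow> (real \<times> enat \<times> (nat \<Rightarrow> real)) measure"
    and D' :: "(real \<times> enat \<times> (nat \<Rightarrow> real)) measure"
    and E :: "nat \<Rightarrow> (real \<times> nat \<times> real) measure"
    and E' :: "(real \<times> nat \<times> real) measure"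
    and \<rho> :: ennreal
  assumes
    "((\<forall>n. weighted_branching_process (M n) (D n) (Q n) (N n) (C n)) \<and>
      weighted_branching_process M' D' Q' N' C' \<and>
      kr_tendsto l1_seq (\<lambda>n. wbp_mu (D n)) (wbp_mu D') \<and>
      \<rho> = wbp_rho D')
     \<or>
     ((\<forall>n. weighted_branching_tree (M n) (E n) (Q n) (N n) (C n)) \<and>
      weighted_branching_tree M' E' Q' N' C' \<and>
      weight_indep E' \<and>
      kr_tendsto l1_pair (\<lambda>n. wbt_nu (E n)) (wbt_nu E') \<and>
      kr_tendsto l1_seq (\<lambda>n. wbt_mu (E n)) (wbt_mu E') \<and>
      \<rho> = wbt_rho E')"
  shows
    "(\<forall>k. kr_tendsto l1_real
            (\<lambda>n. distr (M n) borel (R_upto (Q n) (N n) (C n) k))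
            (distr M' borel (R_upto Q' N' C' k)))
     \<and>
     (\<rho> < 1 \<longrightarrow>
        (AE \<omega> in M'. (\<lambda>k. R_upto Q' N' C' k \<omega>) \<longlonglongrightarrow> R_limit Q' N' C' \<omega>) \<and>
        (\<forall>k :: nat \<Rightarrow> nat. filterlim k at_top sequentially \<longrightarrow>
           kr_tendsto l1_real
             (\<lambda>n. distr (M n) borel (R_upto (Q n) (N n) (C n) (k n)))
             (distr M' borel (R_limit Q' N' C'))))"
  using assms
proof (elim disjE conjE)
  assume P: "\<forall>n. weighted_branching_process (M n) (D n) (Q n) (N n) (C n)"
    and P': "weighted_branching_process M' D' Q' N' C'"
    and conv: "kr_tendsto l1_seq (\<lambda>n. wbp_mu (D n)) (wbp_mu D')"
    and \<rho>: "\<rho> = wbp_rho D'"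
  \<comment> \<open>The measurable sets of \<open>D'\<close> are read off from the law of the root
    vector.\<close>
  have "distr M' wbp_space (wbp_vector Q' N' C' []) = D'"
    using P' by (simp add: weighted_branching_process_def)
  then have "sets D' = sets wbp_space"
    by (metis sets_distr)
  then have "\<rho> = (\<integral>\<^sup>+u. coord_mass {1..} u \<partial>wbp_mu D')"
    unfolding \<rho> by (rule wbp_rho_eq)
  \<comment> \<open>Root and descendants have the same mark law here, so \<open>conv\<close> serves
    in both places.\<close>
  then show ?thesis
    using P by (intro tree_representation_converges[OF _ wbp_tree_representation[OF P'] conv conv]
        wbp_tree_representation) auto
next
  assume P: "\<forall>n. weighted_branching_tree (M n) (E n) (Q n) (N n) (C n)"
    and P': "weighted_branching_tree M' E' Q' N' C'"
    and conv\<^sub>0: "kr_tendsto l1_pair (\<lambda>n. wbt_nu (E n)) (wbt_nu E')"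
    and conv: "kr_tendsto l1_seq (\<lambda>n. wbt_mu (E n)) (wbt_mu E')"
    and \<rho>: "\<rho> = wbt_rho E'"
  have "distr (M n) wbt_space (wbt_vector (Q n) (N n) (C n) []) = E n" for n
    using P by (simp add: weighted_branching_tree_def)
  then have sets: "sets (E n) = sets wbt_space" for n
    by (metis sets_distr)
  have "distr M' wbt_space (wbt_vector Q' N' C' []) = E'"
    using P' by (simp add: weighted_branching_tree_def)
  then have sets': "sets E' = sets wbt_space"
    by (metis sets_distr)
  have "\<rho> = (\<integral>\<^sup>+u. coord_mass {1..} u \<partial>wbt_mu E')"
    unfolding \<rho> by (rule wbt_rho_eq[OF sets'])
  \<comment> \<open>The root laws converge by the assumption on the laws of \<open>(Q, N)\<close>,
    the laws at the other nodes by the one on \<open>wbt_mu\<close>.\<close>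
  then show ?thesis
    using P by (intro tree_representation_converges[OF _ wbt_tree_representation[OF P']
          kr_tendsto_root[OF sets sets' conv\<^sub>0] conv] wbt_tree_representation) auto
qed

end
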